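(* For every admissible level $k$ one has $\overline{\mathrm{Pr}}_k^{\mathcal O_{\rm zero}}=\Lambda_k(\mathfrak g)=\overline{\mathrm{Pr}}_{k,\mathbb Z}$, and this set is non-empty.
   Context: Let $\mathfrak g=\mathfrak{sl}_{n+1}(\mathbb C)$, $n\ge1$, $\mathfrak h$ the traceless diagonal matrices, $\Delta_+=\{\varepsilon_i-\varepsilon_j:i<j\}$, $\Delta_-=-\Delta_+$, $\Pi=\{\alpha_1,\dots,\alpha_n\}$, $\alpha_i=\varepsilon_i-\varepsilon_{i+1}$, $\theta=\alpha_1+\dots+\alpha_n$; $(\cdot,\cdot)$ the invariant form on $\mathfrak h^*$ with $(\alpha,\alpha)=2$ for roots; $\omega_i$ fundamental weights, $P^\vee=\bigoplus\mathbb Z\omega_i$, $P^\vee_+=\bigoplus\mathbb N_0\omega_i$, $\rho=\sum\omega_i$; $W$ the Weyl group, $w\cdot\mu=w(\mu+\rho)-\rho$. Fix $k\in\mathbb Q$ with $k+n+1=p/q$, $p,q\in\mathbb N$ coprime, $p\ge n+1$. $\overline{\mathrm{Pr}}_{k,\mathbb Z}=\{\sum\lambda_i\omega_i:\lambda_i\in\mathbb N_0,\sum\lambda_i\le p-n-1\}$. For $w\in W,\eta\in P^\vee$, $C(w,\eta)$ means: for all $\alpha\in\Delta_+$, $0\le(\eta,\alpha)\le q-1$ if $w(\alpha)\in\Delta_+$ and $1\le(\eta,\alpha)\le q$ if $w(\alpha)\in\Delta_-$. The admissible weights of level $k$: $\overline{\mathrm{Pr}}_k=\{w\cdot(\mu-\tfrac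 pq\eta):\mu\in\overline{\mathrm{Pr}}_{k,\mathbb Z},w\in W,\eta\in P^\vee,C(w,\eta)\}$. $\Lambda_k(\mathfrak g)=\{\mu-\tfrac pq\eta:\mu\in\overline{\mathrm{Pr}}_{k,\mathbb Z},\eta\in P^\vee_+,(\eta,\theta)\le q-1,(\eta,\alpha)=0\ \forall\alpha\in\Pi\}$. For $\mu\in\mathfrak h^*$, $J_\mu$ is the annihilator in $U(\mathfrak g)$ of the simple highest weight module $L(\mu)$ (standard Borel), $\mathcal V(J_\mu)$ the zero locus in $\mathfrak g^*$ of $\mathrm{gr}J_\mu\subset S(\mathfrak g)$; $\overline{\mathrm{Pr}}_k^{\mathcal O_{\rm zero}}=\{\mu\in\overline{\mathrm{Pr}}_k:\mathcal V(J_\mu)=\{0\}\}$. *)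

theory Defs
  imports Complex_Main "HOL-Combinatorics.Permutations"
begin

text \<open>Basis of sl(n+1): E i j (i \<noteq> j, 1 \<le> i,j \<le> n+1) elementary matrices,
  H i = E_ii - E_(i+1)(i+1) (1 \<le> i \<le> n).\<close>

datatype gen = E nat nat | H nat

fun valid_gen :: "nat \<Rightarrow> gen \<Rightarrow> bool" where
  "valid_gen n (E i j) = (i \<noteq> j \<and> 1 \<le> i \<and> i \<le> n + 1 \<and> 1 \<le> j \<and> j \<le> n + 1)"
| "valid_gen n (H i) = (1 \<le> i \<and> i \<le> n)"

fun gmat :: "gen \<Rightarrow> nat \<Rightarrow> nat \<Rightarrow> complex" where
  "gmat (E i j) r s = (if r = i \<and> s = j then 1 else 0)"
| "gmat (H i) r s = (if r = s \<and> r = i then 1 else if r = s \<and> r = i + 1 then -1 else 0)"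

definition comm_mat :: "nat \<Rightarrow> gen \<Rightarrow> gen \<Rightarrow> nat \<Rightarrow> nat \<Rightarrow> complex" where
  "comm_mat n a b r s = (\<Sum>t\<in>{1..n+1}. gmat a r t * gmat b t s - gmat b r t * gmat a t s)"

text \<open>Coordinate of a traceless matrix X with respect to a basis element.\<close>
fun coord :: "(nat \<Rightarrow> nat \<Rightarrow> complex) \<Rightarrow> gen \<Rightarrow> complex" where
  "coord X (E i j) = X i j"
| "coord X (H i) = (\<Sum>r\<in>{1..i}. X r r)"

section \<open>Tensor algebra T(g) as finitely supported functions on words in the basis\<close>

type_synonym telt = "gen list \<Rightarrow> complex"

definition Talg :: "nat \<Rightarrow> telt set" where
  "Talg n = {f. finite {w. f w \<noteq> 0} \<and> (\<forall>w. f w \<noteq> 0 \<longrightarrow> list_all (valid_gen n) w)}"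

definition tmul :: "telt \<Rightarrow> telt \<Rightarrow> telt" where
  "tmul f g = (\<lambda>w. \<Sum>i\<in>{0..length w}. f (take i w) * g (drop i w))"

definition tconst :: "complex \<Rightarrow> telt" where
  "tconst c = (\<lambda>w. if w = [] then c else 0)"

definition tone :: telt where "tone = tconst 1"

definition tgen :: "gen \<Rightarrow> telt" where
  "tgen a = (\<lambda>w. if w = [a] then 1 else 0)"

definition tbracket :: "nat \<Rightarrow> gen \<Rightarrow> gen \<Rightarrow> telt" where
  "tbracket n a b = (\<lambda>w. case w of [c] \<Rightarrow> (if valid_gen n c then coord (comm_mat n a b) c else 0) | _ \<Rightarrow> 0)"

definition trel :: "nat \<Rightarrow> gen \<Rightarrow> gen \<Rightarrow> telt" where
  "trel n a b = (\<lambda>w. tmul (tgen a) (tgen b) w - tmul (tgen b) (tgen a) w - tbracket n a b w)"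

inductive_set two_sided_ideal_gen :: "nat \<Rightarrow> telt set \<Rightarrow> telt set" for n S where
  base: "x \<in> S \<Longrightarrow> x \<in> two_sided_ideal_gen n S"
| zero: "(\<lambda>_. 0) \<in> two_sided_ideal_gen n S"
| add: "x \<in> two_sided_ideal_gen n S \<Longrightarrow> y \<in> two_sided_ideal_gen n S \<Longrightarrow> (\<lambda>w. x w + y w) \<in> two_sided_ideal_gen n S"
| smul: "x \<in> two_sided_ideal_gen n S \<Longrightarrow> (\<lambda>w. c * x w) \<in> two_sided_ideal_gen n S"
| lmul: "y \<in> Talg n \<Longrightarrow> x \<in> two_sided_ideal_gen n S \<Longrightarrow> tmul y x \<in> two_sided_ideal_gen n S"
| rmul: "y \<in> Talg n \<Longrightarrow> x \<in> two_sided_ideal_gen n S \<Longrightarrow> tmul x y \<in> two_sided_ideal_gen n S"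

inductive_set left_ideal_gen :: "nat \<Rightarrow> telt set \<Rightarrow> telt set" for n S where
  base: "x \<in> S \<Longrightarrow> x \<in> left_ideal_gen n S"
| zero: "(\<lambda>_. 0) \<in> left_ideal_gen n S"
| add: "x \<in> left_ideal_gen n S \<Longrightarrow> y \<in> left_ideal_gen n S \<Longrightarrow> (\<lambda>w. x w + y w) \<in> left_ideal_gen n S"
| smul: "x \<in> left_ideal_gen n S \<Longrightarrow> (\<lambda>w. c * x w) \<in> left_ideal_gen n S"
| lmul: "y \<in> Talg n \<Longrightarrow> x \<in> left_ideal_gen n S \<Longrightarrow> tmul y x \<in> left_ideal_gen n S"

definition is_left_ideal :: "nat \<Rightarrow> telt set \<Rightarrow> bool" where
  "is_left_ideal n K \<longleftrightarrow> K \<subseteq> Talg n \<and> (\<lambda>_. 0) \<in> K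
     \<and> (\<forall>x\<in>K. \<forall>y\<in>K. (\<lambda>w. x w + y w) \<in> K)
     \<and> (\<forall>x\<in>K. \<forall>c. (\<lambda>w. c * x w) \<in> K)
     \<and> (\<forall>x\<in>K. \<forall>y\<in>Talg n. tmul y x \<in> K)"

text \<open>U(g) = T(g)/IU; we work with preimages in T(g) of subsets of U(g).\<close>
definition IU :: "nat \<Rightarrow> telt set" where
  "IU n = two_sided_ideal_gen n {trel n a b | a b. valid_gen n a \<and> valid_gen n b}"

text \<open>Weights in h* are given by their coordinates in the basis of fundamental weights:
  mu i = (mu, alpha_i) = mu(H_i), i = 1..n (and 0 outside).\<close>
type_synonym wt = "nat \<Rightarrow> rat"

text \<open>Left ideal of T(g) whose quotient is the Verma module M(mu) (standard Borel).\<close>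
definition verma_left_ideal :: "nat \<Rightarrow> wt \<Rightarrow> telt set" where
  "verma_left_ideal n \<mu> = left_ideal_gen n (IU n
      \<union> {tgen (E i j) | i j. valid_gen n (E i j) \<and> i < j}
      \<union> {(\<lambda>w. tgen (H i) w - tconst (of_rat (\<mu> i)) w) | i. 1 \<le> i \<and> i \<le> n})"

text \<open>Left ideal with T(g)/K = L(mu): preimage of the unique maximal proper submodule of M(mu).\<close>
definition simple_left_ideal :: "nat \<Rightarrow> wt \<Rightarrow> telt set" where
  "simple_left_ideal n \<mu> = \<Union>{K. is_left_ideal n K \<and> verma_left_ideal n \<mu> \<subseteq> K \<and> tone \<notin> K}"

text \<open>Preimage in T(g) of J_mu = Ann_{U(g)} L(mu).\<close>
definition annihilator :: "nat \<Rightarrow> wt \<Rightarrow> telt set" where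
  "annihilator n \<mu> = {u \<in> Talg n. \<forall>v \<in> Talg n. tmul u v \<in> simple_left_ideal n \<mu>}"

definition tdeg :: "telt \<Rightarrow> nat" where
  "tdeg f = Max ({length w | w. f w \<noteq> 0} \<union> {0})"

text \<open>t is a representative of minimal degree of its class in U(g) (PBW filtration degree).\<close>
definition reduced :: "nat \<Rightarrow> telt \<Rightarrow> bool" where
  "reduced n t \<longleftrightarrow> (\<forall>s\<in>Talg n. (\<lambda>w. s w - t w) \<in> IU n \<longrightarrow> tdeg t \<le> tdeg s)"

text \<open>Principal symbol in S(g) of the class of a reduced t, evaluated at xi in g*
  (xi given by its values on the basis).\<close>
definition symbol_eval :: "telt \<Rightarrow> (gen \<Rightarrow> complex) \<Rightarrow> complex" where
  "symbol_eval t \<xi> = (\<Sum>w\<in>{w. t w \<noteq> 0 \<and> length w = tdeg t}. t w * prod_list (map \<xi> w))"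

text \<open>V(J_mu): zero locus in g* of gr J_mu.\<close>
definition assoc_variety :: "nat \<Rightarrow> wt \<Rightarrow> (gen \<Rightarrow> complex) set" where
  "assoc_variety n \<mu> = {\<xi>. (\<forall>a. \<not> valid_gen n a \<longrightarrow> \<xi> a = 0)
      \<and> (\<forall>t\<in>annihilator n \<mu>. reduced n t \<longrightarrow> symbol_eval t \<xi> = 0)}"

definition pos_roots :: "nat \<Rightarrow> (nat \<times> nat) set" where
  "pos_roots n = {(i, j). 1 \<le> i \<and> i < j \<and> j \<le> n + 1}"

text \<open>(mu, eps_i - eps_j) for i < j.\<close>
definition root_pair :: "(nat \<Rightarrow> 'b::comm_monoid_add) \<Rightarrow> nat \<times> nat \<Rightarrow> 'b" where
  "root_pair \<mu> r = (\<Sum>l\<in>{fst r..<snd r}. \<mu> l)"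

text \<open>epsilon-coordinates of a weight: mu = sum_a m_a eps_a, m_a = mu_a + ... + mu_n.\<close>
definition ecoord :: "nat \<Rightarrow> wt \<Rightarrow> nat \<Rightarrow> rat" where
  "ecoord n \<mu> a = (\<Sum>l\<in>{a..n}. \<mu> l)"

text \<open>Weyl group W = S_(n+1) as permutations sigma of {1..n+1}, w(eps_a) = eps_(sigma a);
  (w mu, alpha_l) = (mu, w^-1 alpha_l).\<close>
definition weyl_act :: "nat \<Rightarrow> (nat \<Rightarrow> nat) \<Rightarrow> wt \<Rightarrow> wt" where
  "weyl_act n \<sigma> \<mu> = (\<lambda>l. if 1 \<le> l \<and> l \<le> n
      then ecoord n \<mu> (inv \<sigma> l) - ecoord n \<mu> (inv \<sigma> (l + 1)) else 0)"

definition rho :: "nat \<Rightarrow> wt" where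
  "rho n = (\<lambda>l. if 1 \<le> l \<and> l \<le> n then 1 else 0)"

definition dot_act :: "nat \<Rightarrow> (nat \<Rightarrow> nat) \<Rightarrow> wt \<Rightarrow> wt" where
  "dot_act n \<sigma> \<mu> = (\<lambda>l. weyl_act n \<sigma> (\<lambda>i. \<mu> i + rho n i) l - rho n l)"

definition supported :: "nat \<Rightarrow> (nat \<Rightarrow> 'b::zero) \<Rightarrow> bool" where
  "supported n f \<longleftrightarrow> (\<forall>i. \<not> (1 \<le> i \<and> i \<le> n) \<longrightarrow> f i = 0)"

text \<open>\<open>Pr_{k,Z}\<close> for k + n + 1 = p/q.\<close>
definition PrZ :: "nat \<Rightarrow> nat \<Rightarrow> wt set" where
  "PrZ n p = {\<mu>. supported n \<mu> \<and> (\<forall>i. \<mu> i \<in> \<nat>)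
      \<and> (\<Sum>i\<in>{1..n}. \<mu> i) \<le> of_nat p - of_nat n - 1}"

definition shift :: "nat \<Rightarrow> nat \<Rightarrow> wt \<Rightarrow> (nat \<Rightarrow> int) \<Rightarrow> wt" where
  "shift p q \<mu> \<eta> = (\<lambda>l. \<mu> l - (of_nat p / of_nat q) * of_int (\<eta> l))"

definition cond_C :: "nat \<Rightarrow> nat \<Rightarrow> (nat \<Rightarrow> nat) \<Rightarrow> (nat \<Rightarrow> int) \<Rightarrow> bool" where
  "cond_C n q \<sigma> \<eta> \<longleftrightarrow> (\<forall>r\<in>pos_roots n.
      (if \<sigma> (fst r) < \<sigma> (snd r)
       then 0 \<le> root_pair \<eta> r \<and> root_pair \<eta> r \<le> int q - 1
       else 1 \<le> root_pair \<eta> r \<and> root_pair \<eta> r \<le> int q))"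

definition Pr_adm :: "nat \<Rightarrow> nat \<Rightarrow> nat \<Rightarrow> wt set" where
  "Pr_adm n p q = {dot_act n \<sigma> (shift p q \<mu> \<eta>) | \<mu> \<sigma> \<eta>.
      \<mu> \<in> PrZ n p \<and> \<sigma> permutes {1..n+1} \<and> supported n \<eta> \<and> cond_C n q \<sigma> \<eta>}"

definition Lambda_k :: "nat \<Rightarrow> nat \<Rightarrow> nat \<Rightarrow> wt set" where
  "Lambda_k n p q = {shift p q \<mu> \<eta> | \<mu> \<eta>.
      \<mu> \<in> PrZ n p \<and> supported n \<eta> \<and> (\<forall>l. 0 \<le> \<eta> l)
      \<and> (\<Sum>l\<in>{1..n}. \<eta> l) \<le> int q - 1 \<and> (\<forall>i\<in>{1..n}. \<eta> i = 0)}"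

definition Pr_zero :: "nat \<Rightarrow> nat \<Rightarrow> nat \<Rightarrow> wt set" where
  "Pr_zero n p q = {\<mu> \<in> Pr_adm n p q. assoc_variety n \<mu> = {(\<lambda>_. 0)}}"

end

theory Submission
  imports Defs
begin

text \<open>
  The whole statement reduces to: \<open>\<V>(J\<^sub>\<mu>) = {0}\<close> iff every \<open>(\<mu>, \<alpha>\<^sub>i)\<close> is a natural number.

  If \<open>(\<mu>, \<alpha>\<^sub>i)\<close> is not a natural number, the functional dual to \<open>F\<^sub>i = E\<^sub>i\<^sub>+\<^sub>1\<^sub>,\<^sub>i\<close> lies in \<open>\<V>(J\<^sub>\<mu>)\<close>.
  Indeed, \<open>ad H\<^sub>i\<close> has eigenvalues at least \<open>-2\<close> on the basis of \<open>g\<close>, with \<open>-2\<close> attained only at \<open>F\<^sub>i\<close>,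
  so the component of weight \<open>-2d\<close> of an element of degree \<open>d\<close> is a multiple of \<open>F\<^sub>i\<^sup>d\<close>. If the symbol of an
  element of \<open>J\<^sub>\<mu>\<close> did not vanish at the functional, \<open>F\<^sub>i\<^sup>d\<close> would kill the highest weight vector
  of \<open>L(\<mu>)\<close>, against \<open>E\<^sub>i F\<^sub>i\<^sup>N\<^sup>+\<^sup>1 v = (N + 1) (\<mu>\<^sub>i - N) F\<^sub>i\<^sup>N v\<close>.

  If all \<open>(\<mu>, \<alpha>\<^sub>i)\<close> are natural numbers, a tensor power of the vector representation contains a
  highest weight vector of weight \<open>\<mu>\<close>, and on it a power of every \<open>E\<^sub>i\<^sub>j\<close> and a polynomial in every
  \<open>H\<^sub>i\<close> act by zero. Instead of the PBW theorem, a single matrix coefficient on \<open>V\<^sup>\<otimes>\<^sup>N\<close> shows that these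
  elements have no representative of smaller degree: an operator of filtration degree below \<open>N\<close>
  cannot change all \<open>N\<close> tensor factors.

  Finally, an admissible weight with natural coordinates is in \<open>Pr\<^sub>k\<^sub>,\<^sub>Z\<close> because, with \<open>\<theta> = w(\<alpha>)\<close>, the
  condition \<open>C(w, \<eta>)\<close> gives \<open>(\<mu> + \<rho>, \<theta>) \<le> p - 1\<close> both for positive and for negative \<open>\<alpha>\<close>.
\<close>

section \<open>The tensor algebra\<close>

definition tmono :: "gen list \<Rightarrow> telt" where
  "tmono u = (\<lambda>w. if w = u then 1 else 0)"

lemma tone_eq_tmono: "tone = tmono []"
  by (simp add: tone_def tconst_def tmono_def)

lemma tgen_eq_tmono: "tgen a = tmono [a]"
  by (simp add: tgen_def tmono_def)

lemma splits_eq: "{p. fst p @ snd p = w} = (\<lambda>i. (take i w, drop i w)) ` {0..length w}"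
proof -
  have "p \<in> (\<lambda>i. (take i w, drop i w)) ` {0..length w}" if "fst p @ snd p = w" for p
    using that by (intro image_eqI[where x = "length (fst p)"]) auto
  then show ?thesis by auto
qed

lemma finite_splits: "finite {p. fst p @ snd p = w}"
  by (simp add: splits_eq)

text \<open>Indexing by pairs of words rather than by cut positions leaves a single nonzero term
  when a factor is a monomial, and allows regrouping along concatenation.\<close>

lemma tmul_eq_sum_splits:
  "tmul f g w = (\<Sum>p | fst p @ snd p = w. f (fst p) * g (snd p))"
proof -
  have "inj_on (\<lambda>i. (take i w, drop i w)) {0..length w}"
  proof (rule inj_onI)
    fix i j assume "i \<in> {0..length w}" "j \<in> {0..length w}" "(take i w, drop i w) = (take j w, drop j w)"
    then have "length (take i w) = length (take j w)" "i \<le> length w" "j \<le> length w" by auto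
    then show "i = j" by simp
  qed
  then show ?thesis
    by (simp add: splits_eq tmul_def sum.reindex)
qed

lemma tmul_tmono: "tmul (tmono u) (tmono v) = tmono (u @ v)"
proof
  fix w
  have "tmul (tmono u) (tmono v) w = (\<Sum>p | fst p @ snd p = w. if p = (u, v) then 1 else 0)"
    unfolding tmul_eq_sum_splits by (intro sum.cong) (auto simp: tmono_def prod_eq_iff)
  also have "\<dots> = tmono (u @ v) w"
    using finite_splits[of w] by (auto simp: tmono_def)
  finally show "tmul (tmono u) (tmono v) w = tmono (u @ v) w" .
qed

lemma tmul_diff_left: "tmul (\<lambda>w. x w - y w) z = (\<lambda>w. tmul x z w - tmul y z w)"
  by (simp add: tmul_def algebra_simps sum_subtractf)

lemma tmul_smult_left: "tmul (\<lambda>w. c * x w) z = (\<lambda>w. c * tmul x z w)"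
  by (simp add: tmul_def algebra_simps sum_distrib_left)

lemma tmul_diff_right: "tmul z (\<lambda>w. x w - y w) = (\<lambda>w. tmul z x w - tmul z y w)"
  by (simp add: tmul_def algebra_simps sum_subtractf)

lemma tmul_smult_right: "tmul z (\<lambda>w. c * x w) = (\<lambda>w. c * tmul z x w)"
  by (simp add: tmul_def algebra_simps sum_distrib_left)

lemma tmul_tone_right: "tmul x tone = x"
proof
  fix w
  have "tmul x tone w = (\<Sum>p | fst p @ snd p = w. if p = (w, []) then x w else 0)"
    unfolding tmul_eq_sum_splits
    by (intro sum.cong) (auto simp: tone_eq_tmono tmono_def prod_eq_iff)
  also have "\<dots> = x w" using finite_splits[of w] by simp
  finally show "tmul x tone w = x w" .
qed

lemma Talg_finite: "x \<in> Talg n \<Longrightarrow> finite {w. x w \<noteq> 0}"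
  by (simp add: Talg_def)

lemma Talg_valid: "x \<in> Talg n \<Longrightarrow> x w \<noteq> 0 \<Longrightarrow> list_all (valid_gen n) w"
  by (simp add: Talg_def)

lemma zero_in_Talg: "(\<lambda>_. 0) \<in> Talg n"
  by (simp add: Talg_def)

lemma add_in_Talg: "x \<in> Talg n \<Longrightarrow> y \<in> Talg n \<Longrightarrow> (\<lambda>w. x w + y w) \<in> Talg n"
  unfolding Talg_def
  by (auto intro: finite_subset[of _ "{w. x w \<noteq> 0} \<union> {w. y w \<noteq> 0}"]) (metis add.left_neutral)

lemma smult_in_Talg: "x \<in> Talg n \<Longrightarrow> (\<lambda>w. c * x w) \<in> Talg n"
  unfolding Talg_def by (auto intro: finite_subset[of _ "{w. x w \<noteq> 0}"])

lemma diff_in_Talg: "x \<in> Talg n \<Longrightarrow> y \<in> Talg n \<Longrightarrow> (\<lambda>w. x w - y w) \<in> Talg n"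
  using add_in_Talg[of x n "\<lambda>w. (-1) * y w"] smult_in_Talg[of y n "-1"] by simp

lemma tmono_in_Talg: "list_all (valid_gen n) u \<Longrightarrow> tmono u \<in> Talg n"
  by (auto simp: Talg_def tmono_def)

lemma tconst_in_Talg: "tconst c \<in> Talg n"
  by (auto simp: Talg_def tconst_def)

lemma tmul_nonzeroD:
  assumes "tmul x y w \<noteq> 0"
  obtains u v where "w = u @ v" "x u \<noteq> 0" "y v \<noteq> 0"
proof -
  from assms obtain p where "p \<in> {p. fst p @ snd p = w}" "x (fst p) * y (snd p) \<noteq> 0"
    unfolding tmul_eq_sum_splits by (rule sum.not_neutral_contains_not_neutral)
  then show ?thesis by (intro that[of "fst p" "snd p"]) auto
qed

lemma tmul_in_Talg:
  assumes "x \<in> Talg n" "y \<in> Talg n"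
  shows "tmul x y \<in> Talg n"
proof -
  have "{w. tmul x y w \<noteq> 0} \<subseteq> (\<lambda>(u, v). u @ v) ` ({w. x w \<noteq> 0} \<times> {w. y w \<noteq> 0})"
    by (force elim: tmul_nonzeroD)
  moreover have "list_all (valid_gen n) w" if "tmul x y w \<noteq> 0" for w
    using that assms by (auto elim!: tmul_nonzeroD dest: Talg_valid)
  ultimately show ?thesis
    using assms by (auto simp: Talg_def intro: finite_subset)
qed

lemma finite_gens: "finite {g. valid_gen n g}"
proof -
  have "{g. valid_gen n g} \<subseteq> (\<lambda>(i, j). E i j) ` ({..n+1} \<times> {..n+1}) \<union> H ` {..n+1}"
    by (auto elim!: valid_gen.elims)
  then show ?thesis by (rule finite_subset) auto
qed

lemma tbracket_support: "{w. tbracket n a b w \<noteq> 0} \<subseteq> (\<lambda>g. [g]) ` {g. valid_gen n g}"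
proof -
  have "w \<in> (\<lambda>g. [g]) ` {g. valid_gen n g}" if "tbracket n a b w \<noteq> 0" for w
    using that unfolding tbracket_def by (auto split: list.splits if_splits)
  then show ?thesis by blast
qed

lemma tbracket_in_Talg: "tbracket n a b \<in> Talg n"
proof -
  have "finite {w. tbracket n a b w \<noteq> 0}"
    by (rule finite_subset[OF tbracket_support]) (simp add: finite_gens)
  then show ?thesis using tbracket_support[of n a b] by (fastforce simp: Talg_def)
qed

lemma trel_in_Talg: "valid_gen n a \<Longrightarrow> valid_gen n b \<Longrightarrow> trel n a b \<in> Talg n"
  unfolding trel_def tgen_eq_tmono tmul_tmono
  by (intro diff_in_Talg tmono_in_Talg tbracket_in_Talg) auto

lemma IU_subset_Talg: "IU n \<subseteq> Talg n"
proof
  fix x assume "x \<in> IU n"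
  then show "x \<in> Talg n" unfolding IU_def
    by induction (auto intro: trel_in_Talg zero_in_Talg add_in_Talg smult_in_Talg tmul_in_Talg)
qed

section \<open>Left ideals containing the Verma ideal\<close>

text \<open>The closure properties shared by \<open>verma_left_ideal\<close> and by every
  \<open>is_left_ideal\<close>, so that linear manipulations serve both.\<close>

definition lin_subspace :: "telt set \<Rightarrow> bool" where
  "lin_subspace K \<longleftrightarrow> (\<lambda>_. 0) \<in> K \<and> (\<forall>x\<in>K. \<forall>y\<in>K. (\<lambda>w. x w + y w) \<in> K)
     \<and> (\<forall>x\<in>K. \<forall>c. (\<lambda>w. c * x w) \<in> K)"

lemma lin_subspace_add: "lin_subspace K \<Longrightarrow> x \<in> K \<Longrightarrow> y \<in> K \<Longrightarrow> (\<lambda>w. x w + y w) \<in> K"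
  unfolding lin_subspace_def by blast

lemma lin_subspace_diff: "lin_subspace K \<Longrightarrow> x \<in> K \<Longrightarrow> y \<in> K \<Longrightarrow> (\<lambda>w. x w - y w) \<in> K"
proof -
  assume K: "lin_subspace K" "x \<in> K" "y \<in> K"
  then have "(\<lambda>w. (-1) * y w) \<in> K" unfolding lin_subspace_def by blast
  with K have "(\<lambda>w. x w + (-1) * y w) \<in> K" by (auto simp: lin_subspace_def)
  then show ?thesis by simp
qed

lemma lin_subspace_sum:
  assumes "lin_subspace K" "finite S" "\<And>s. s \<in> S \<Longrightarrow> f s \<in> K"
  shows "(\<lambda>w. \<Sum>s\<in>S. c s * f s w) \<in> K"
  using assms(2,3)
proof induction
  case empty
  then show ?case using assms(1) by (simp add: lin_subspace_def)
next
  case (insert s S)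
  then have "(\<lambda>w. c s * f s w) \<in> K" "(\<lambda>w. \<Sum>s\<in>S. c s * f s w) \<in> K"
    using assms(1) by (auto simp: lin_subspace_def)
  then have "(\<lambda>w. c s * f s w + (\<Sum>s\<in>S. c s * f s w)) \<in> K"
    using assms(1) by (auto simp: lin_subspace_def)
  then show ?case using insert by simp
qed

lemma is_left_ideal_lin_subspace: "is_left_ideal n K \<Longrightarrow> lin_subspace K"
  by (simp add: is_left_ideal_def lin_subspace_def)

lemma verma_lin_subspace: "lin_subspace (verma_left_ideal n \<mu>)"
  unfolding lin_subspace_def verma_left_ideal_def by (auto intro: left_ideal_gen.intros)

lemma verma_tmul: "y \<in> Talg n \<Longrightarrow> x \<in> verma_left_ideal n \<mu> \<Longrightarrow> tmul y x \<in> verma_left_ideal n \<mu>"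
  unfolding verma_left_ideal_def by (rule left_ideal_gen.lmul)

text \<open>The right factor \<open>y\<close> is absorbed by the two-sided ideal
  \<open>IU n\<close>. This permits commuting the first two letters of a word modulo the Verma
  ideal.\<close>

lemma trel_tmul_in_verma:
  assumes "valid_gen n a" "valid_gen n b" "y \<in> Talg n"
  shows "tmul (trel n a b) y \<in> verma_left_ideal n \<mu>"
proof -
  have "tmul (trel n a b) y \<in> IU n"
    unfolding IU_def using assms
    by (intro two_sided_ideal_gen.rmul two_sided_ideal_gen.base) auto
  then show ?thesis unfolding verma_left_ideal_def
    by (intro left_ideal_gen.base) auto
qed

lemma trel_tmul_tmono:
  assumes "tbracket n a b = (\<lambda>w. c * tmono [g] w)"
  shows "tmul (trel n a b) (tmono v)
    = (\<lambda>w. tmono (a # b # v) w - tmono (b # a # v) w - c * tmono (g # v) w)"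
  unfolding trel_def assms tgen_eq_tmono tmul_tmono
  by (simp add: tmul_diff_left tmul_smult_left tmul_tmono)

section \<open>Weights of words under \<open>ad (H i)\<close>\<close>

definition hval :: "nat \<Rightarrow> nat \<Rightarrow> int" where
  "hval i r = (if r = i then 1 else if r = i + 1 then -1 else 0)"

text \<open>The eigenvalue of \<open>ad (H i)\<close> on a basis element, kept as an integer so that
  weights can be ordered.\<close>

fun gwt :: "nat \<Rightarrow> gen \<Rightarrow> int" where
  "gwt i (E a b) = hval i a - hval i b"
| "gwt i (H j) = 0"

definition wwt :: "nat \<Rightarrow> gen list \<Rightarrow> int" where
  "wwt i w = sum_list (map (gwt i) w)"

lemma gmat_H_eq: "gmat (H i) r s = (if r = s then of_int (hval i r) else 0)"
  by (simp add: hval_def)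

lemma sum_hval: "1 \<le> i \<Longrightarrow> (\<Sum>r\<in>{1..m}. hval i r) = (if m = i then 1 else 0)"
proof -
  assume i: "1 \<le> i"
  have "(\<Sum>r\<in>{1..m}. hval i r)
      = (\<Sum>r\<in>{1..m}. (if r = i then 1 else 0)) - (\<Sum>r\<in>{1..m}. (if r = i + 1 then 1 else 0))"
    unfolding sum_subtractf[symmetric] by (intro sum.cong) (auto simp: hval_def)
  then show ?thesis using i by auto
qed

lemma comm_mat_H:
  assumes i: "1 \<le> i" "i \<le> n" and g: "valid_gen n g"
  shows "comm_mat n (H i) g r s = of_int (gwt i g) * gmat g r s"
proof -
  have "comm_mat n (H i) g r s
     = (\<Sum>t\<in>{1..n+1}. (if t = r then of_int (hval i r) * gmat g r s else 0))
     - (\<Sum>t\<in>{1..n+1}. (if t = s then of_int (hval i s) * gmat g r s else 0))"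
    unfolding comm_mat_def sum_subtractf[symmetric]
    by (intro sum.cong refl) (auto simp: gmat_H_eq simp del: gmat.simps)
  also have "\<dots> = of_int (hval i r - hval i s) * gmat g r s"
  proof -
    \<comment> \<open>For indices outside the summation range the delta sums are 0, which agrees
      with the claim because \<open>H i\<close> has no entries there.\<close>
    have "hval i r = 0" if "r \<notin> {1..n+1}" for r using that i by (auto simp: hval_def)
    then show ?thesis by (auto simp: algebra_simps)
  qed
  also have "\<dots> = of_int (gwt i g) * gmat g r s"
    by (cases g) auto
  finally show ?thesis .
qed

lemma coord_scale: "coord (\<lambda>r s. c * X r s) g = c * coord X g"
  by (cases g) (auto simp: sum_distrib_left)

text \<open>\<open>coord\<close> is the dual basis: on the Cartan part, the partial sums of the
  diagonal \<open>1, -1\<close> of \<open>H i\<close> vanish except the one ending at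
  \<open>i\<close>.\<close>

lemma coord_gmat:
  assumes "valid_gen n g" "valid_gen n g'"
  shows "coord (gmat g) g' = (if g' = g then 1 else 0)"
proof (cases g')
  case (H j)
  show ?thesis
  proof (cases g)
    case (E a b)
    with H assms show ?thesis by (auto intro!: sum.neutral)
  next
    case g: (H i)
    have "coord (gmat g) g' = (\<Sum>r\<in>{1..j}. of_int (hval i r))"
      unfolding H g coord.simps gmat_H_eq by simp
    also have "\<dots> = of_int (\<Sum>r\<in>{1..j}. hval i r)" by simp
    also have "\<dots> = (if j = i then 1 else 0)" using assms g by (subst sum_hval) auto
    finally show ?thesis using H g by auto
  qed
qed (use assms in \<open>cases g; auto\<close>)

lemma tbracket_scalar:
  assumes "valid_gen n g" "comm_mat n a b = (\<lambda>r s. c * gmat g r s)"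
  shows "tbracket n a b = (\<lambda>w. c * tmono [g] w)"
  unfolding tbracket_def assms(2) coord_scale
  using coord_gmat[OF assms(1)] assms(1) by (auto simp: tmono_def fun_eq_iff split: list.splits)

lemma tbracket_H:
  assumes "1 \<le> i" "i \<le> n" "valid_gen n g"
  shows "tbracket n (H i) g = (\<lambda>w. of_int (gwt i g) * tmono [g] w)"
  by (rule tbracket_scalar) (use assms comm_mat_H in \<open>auto simp: fun_eq_iff\<close>)

lemma tbracket_EF:
  assumes "1 \<le> i" "i \<le> n"
  shows "tbracket n (E i (i+1)) (E (i+1) i) = (\<lambda>w. 1 * tmono [H i] w)"
proof (rule tbracket_scalar)
  show "comm_mat n (E i (i+1)) (E (i+1) i) = (\<lambda>r s. 1 * gmat (H i) r s)"
  proof (intro ext)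
    fix r s
    have "comm_mat n (E i (i+1)) (E (i+1) i) r s
      = (\<Sum>t\<in>{1..n+1}. if t = i+1 then (if r = i \<and> s = i then 1 else 0) else 0)
      - (\<Sum>t\<in>{1..n+1}. if t = i then (if r = i+1 \<and> s = i+1 then 1 else 0) else 0)"
      unfolding comm_mat_def sum_subtractf[symmetric] by (intro sum.cong) auto
    also have "\<dots> = (if r = i \<and> s = i then 1 else 0) - (if r = i+1 \<and> s = i+1 then 1 else 0)"
      using assms by (simp only: sum.delta finite_atLeastAtMost) auto
    also have "\<dots> = 1 * gmat (H i) r s" by auto
    finally show "comm_mat n (E i (i+1)) (E (i+1) i) r s = 1 * gmat (H i) r s" .
  qed
qed (use assms in auto)

text \<open>Moving \<open>H i\<close> to the right past a letter costs the weight of that letter,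
  and at the end of the word it becomes the scalar \<open>\<mu> i\<close>. So each word is a weight
  vector of the Verma module.\<close>

lemma H_tmono_in_verma:
  assumes "1 \<le> i" "i \<le> n" "list_all (valid_gen n) w"
  shows "(\<lambda>u. tmono (H i # w) u - (of_rat (\<mu> i) + of_int (wwt i w)) * tmono w u)
    \<in> verma_left_ideal n \<mu>"
  using assms(3)
proof (induction w)
  case Nil
  have "(\<lambda>w. tgen (H i) w - tconst (of_rat (\<mu> i)) w) \<in> verma_left_ideal n \<mu>"
    unfolding verma_left_ideal_def using assms(1,2) by (intro left_ideal_gen.base) auto
  moreover have "tconst (of_rat (\<mu> i)) = (\<lambda>w. of_rat (\<mu> i) * tmono [] w)"
    by (auto simp: tconst_def tmono_def)
  ultimately show ?case by (simp add: tgen_eq_tmono wwt_def)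
next
  case (Cons g w)
  let ?c = "of_rat (\<mu> i) + of_int (wwt i w) :: complex"
  have g: "valid_gen n g" "list_all (valid_gen n) w" using Cons.prems by auto
  have 1: "tmul (trel n (H i) g) (tmono w) \<in> verma_left_ideal n \<mu>"
    using g assms by (intro trel_tmul_in_verma tmono_in_Talg) auto
  have "tmul (tmono [g]) (\<lambda>u. tmono (H i # w) u - ?c * tmono w u) \<in> verma_left_ideal n \<mu>"
    using Cons.IH g by (intro verma_tmul tmono_in_Talg) auto
  then have 2: "(\<lambda>u. tmono (g # H i # w) u - ?c * tmono (g # w) u) \<in> verma_left_ideal n \<mu>"
    by (simp add: tmul_diff_right tmul_smult_right tmul_tmono)
  have "(\<lambda>u. (tmono (H i # g # w) u - tmono (g # H i # w) u - of_int (gwt i g) * tmono (g # w) u)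
      + (tmono (g # H i # w) u - ?c * tmono (g # w) u)) \<in> verma_left_ideal n \<mu>"
    using 1 2 verma_lin_subspace[of n \<mu>]
    unfolding trel_tmul_tmono[OF tbracket_H[OF assms(1,2) g(1)]] lin_subspace_def by fast
  then show ?case by (simp add: wwt_def algebra_simps)
qed

text \<open>The usual sl(2) computation: \<open>E F = F E + H\<close>, where \<open>H\<close> acts
  on the N-th power of \<open>F\<close> by \<open>\<mu> i - 2 N\<close>.\<close>

lemma E_F_power_in_verma:
  assumes "1 \<le> i" "i \<le> n"
  shows "(\<lambda>u. tmono (E i (i+1) # replicate (Suc N) (E (i+1) i)) u
       - of_nat (Suc N) * (of_rat (\<mu> i) - of_nat N) * tmono (replicate N (E (i+1) i)) u)
    \<in> verma_left_ideal n \<mu>"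
proof (induction N)
  let ?V = "verma_left_ideal n \<mu>" and ?e = "E i (i+1)" and ?f = "E (i+1) i"
  let ?F = "\<lambda>N. replicate N ?f"
  let ?m = "of_rat (\<mu> i) :: complex"
  have V: "lin_subspace ?V" by (rule verma_lin_subspace)
  have val: "valid_gen n ?e" "valid_gen n ?f" "valid_gen n (H i)" using assms by auto
  have valF: "list_all (valid_gen n) (?F N)" for N
    using val(2) by (induction N) auto
  have wtF: "wwt i (?F N) = - 2 * int N" for N
    by (induction N) (auto simp: wwt_def hval_def)
  have rel: "(\<lambda>w. tmono (?e # ?f # ?F N) w - tmono (?f # ?e # ?F N) w - 1 * tmono (H i # ?F N) w) \<in> ?V" for N
    using trel_tmul_in_verma[OF val(1,2) tmono_in_Talg[OF valF[of N]], of \<mu>]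
    unfolding trel_tmul_tmono[OF tbracket_EF[OF assms]] .
  have H: "(\<lambda>u. tmono (H i # ?F N) u - (?m + of_int (wwt i (?F N))) * tmono (?F N) u) \<in> ?V" for N
    by (rule H_tmono_in_verma[OF assms valF])
  {
    case 0
    \<comment> \<open>At the start \<open>E\<close> meets the highest weight vector, which it
      kills.\<close>
    have "tgen ?e \<in> {tgen (E i j) | i j. valid_gen n (E i j) \<and> i < j}" using val(1) by force
    then have "tgen ?e \<in> ?V" unfolding verma_left_ideal_def
      by (intro left_ideal_gen.base) blast
    then have "tmul (tmono [?f]) (tmono [?e]) \<in> ?V"
      unfolding tgen_eq_tmono using val by (intro verma_tmul tmono_in_Talg) auto
    then have 1: "tmono (?f # ?e # ?F 0) \<in> ?V" by (simp add: tmul_tmono)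
    have "(\<lambda>u. (tmono (?e # ?f # ?F 0) u - tmono (?f # ?e # ?F 0) u - 1 * tmono (H i # ?F 0) u)
        + tmono (?f # ?e # ?F 0) u) \<in> ?V"
      by (rule lin_subspace_add[OF V rel[of "0"] 1])
    then have "(\<lambda>u. ((tmono (?e # ?f # ?F 0) u - tmono (?f # ?e # ?F 0) u - 1 * tmono (H i # ?F 0) u)
        + tmono (?f # ?e # ?F 0) u)
        + (tmono (H i # ?F 0) u - (?m + of_int (wwt i (?F 0))) * tmono (?F 0) u)) \<in> ?V"
      by (rule lin_subspace_add[OF V _ H[of "0"]])
    then show ?case by (simp add: wwt_def)
  next
    case (Suc N)
    let ?M = "Suc N" and ?c = "of_nat (Suc N) * (?m - of_nat N)"
    have "tmul (tmono [?f]) (\<lambda>u. tmono (?e # ?F ?M) u - ?c * tmono (?F N) u) \<in> ?V"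
      using Suc val by (intro verma_tmul tmono_in_Talg) auto
    then have 1: "(\<lambda>u. tmono (?f # ?e # ?F ?M) u - ?c * tmono (?F ?M) u) \<in> ?V"
      by (simp add: tmul_diff_right tmul_smult_right tmul_tmono)
    have "(\<lambda>u. (tmono (?e # ?f # ?F ?M) u - tmono (?f # ?e # ?F ?M) u - 1 * tmono (H i # ?F ?M) u)
        + (tmono (?f # ?e # ?F ?M) u - ?c * tmono (?F ?M) u)) \<in> ?V"
      by (rule lin_subspace_add[OF V rel[of "?M"] 1])
    then have "(\<lambda>u. ((tmono (?e # ?f # ?F ?M) u - tmono (?f # ?e # ?F ?M) u - 1 * tmono (H i # ?F ?M) u)
        + (tmono (?f # ?e # ?F ?M) u - ?c * tmono (?F ?M) u))
        + (tmono (H i # ?F ?M) u - (?m + of_int (wwt i (?F ?M))) * tmono (?F ?M) u)) \<in> ?V"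
      by (rule lin_subspace_add[OF V _ H[of "?M"]])
    \<comment> \<open>The coefficients combine by
      \<open>(N + 1) (m - N) + m - 2 (N + 1) = (N + 2) (m - (N + 1))\<close>.\<close>
    then show ?case
      by (rule back_subst[where P = "\<lambda>x. x \<in> ?V"]) (simp add: wtF[of "Suc N", simplified] fun_eq_iff algebra_simps)
  }
qed

text \<open>Left multiplication by \<open>H i\<close> preserves \<open>K\<close> and, modulo the
  Verma ideal, scales each word by \<open>\<mu> i\<close> plus its weight; subtracting the multiple
  \<open>\<mu> i\<close> of \<open>x\<close> leaves the weight alone.\<close>

lemma left_ideal_weight_op:
  assumes K: "is_left_ideal n K" "verma_left_ideal n \<mu> \<subseteq> K" and i: "1 \<le> i" "i \<le> n" and x: "x \<in> K"
  shows "(\<lambda>w. of_int (wwt i w) * x w) \<in> K"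
proof -
  let ?S = "{w. x w \<noteq> 0}" and ?m = "of_rat (\<mu> i) :: complex"
  have T: "x \<in> Talg n" using K x by (auto simp: is_left_ideal_def)
  note fin = Talg_finite[OF T]
  have lin: "lin_subspace K" using K(1) by (rule is_left_ideal_lin_subspace)
  have exp: "x = (\<lambda>u. \<Sum>w\<in>?S. x w * tmono w u)"
  proof
    fix u
    have "(\<Sum>w\<in>?S. x w * tmono w u) = (\<Sum>w\<in>?S. if u = w then x u else 0)"
      by (intro sum.cong) (auto simp: tmono_def)
    also have "\<dots> = x u" using fin by simp
    finally show "x u = (\<Sum>w\<in>?S. x w * tmono w u)" by simp
  qed
  have "(\<lambda>u. \<Sum>w\<in>?S. x w * (tmono (H i # w) u - (?m + of_int (wwt i w)) * tmono w u)) \<in> K"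
    by (rule lin_subspace_sum[OF lin fin])
      (use H_tmono_in_verma[OF i] Talg_valid[OF T] K(2) in blast)
  moreover have "tmul (tgen (H i)) x = (\<lambda>u. \<Sum>w\<in>?S. x w * tmono (H i # w) u)"
  proof
    fix u
    have "tmul (tgen (H i)) x u = tmul (tgen (H i)) (\<lambda>u. \<Sum>w\<in>?S. x w * tmono w u) u"
      using exp by simp
    also have "\<dots> = (\<Sum>w\<in>?S. x w * tmul (tgen (H i)) (tmono w) u)"
      unfolding tmul_def sum_distrib_left by (subst sum.swap) (simp add: algebra_simps)
    finally show "tmul (tgen (H i)) x u = (\<Sum>w\<in>?S. x w * tmono (H i # w) u)"
      by (simp add: tgen_eq_tmono tmul_tmono)
  qed
  moreover have "tmul (tgen (H i)) x \<in> K"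
    using K(1) x i unfolding is_left_ideal_def tgen_eq_tmono
    by (auto simp: tmono_in_Talg)
  ultimately have "(\<lambda>u. (\<Sum>w\<in>?S. x w * tmono (H i # w) u)
     - (\<Sum>w\<in>?S. x w * (tmono (H i # w) u - (?m + of_int (wwt i w)) * tmono w u))) \<in> K"
    using lin_subspace_diff[OF lin] by presburger
  moreover have "(\<lambda>u. ?m * x u) \<in> K" using lin x by (auto simp: lin_subspace_def)
  ultimately have "(\<lambda>u. ((\<Sum>w\<in>?S. x w * tmono (H i # w) u)
     - (\<Sum>w\<in>?S. x w * (tmono (H i # w) u - (?m + of_int (wwt i w)) * tmono w u))) - ?m * x u) \<in> K"
    by (rule lin_subspace_diff[OF lin])
  moreover have "((\<Sum>w\<in>?S. x w * tmono (H i # w) u)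
     - (\<Sum>w\<in>?S. x w * (tmono (H i # w) u - (?m + of_int (wwt i w)) * tmono w u))) - ?m * x u
     = of_int (wwt i u) * x u" for u
  proof -
    have "(\<Sum>w\<in>?S. x w * tmono (H i # w) u)
     - (\<Sum>w\<in>?S. x w * (tmono (H i # w) u - (?m + of_int (wwt i w)) * tmono w u))
      = (\<Sum>w\<in>?S. if u = w then (?m + of_int (wwt i u)) * x u else 0)"
      unfolding sum_subtractf[symmetric]
      by (intro sum.cong) (auto simp: tmono_def algebra_simps)
    also have "\<dots> = (?m + of_int (wwt i u)) * x u" using fin by simp
    finally show ?thesis by (simp add: algebra_simps)
  qed
  ultimately show ?thesis by simp
qed

lemma left_ideal_weight_poly:
  assumes K: "is_left_ideal n K" "verma_left_ideal n \<mu> \<subseteq> K" and i: "1 \<le> i" "i \<le> n" and x: "x \<in> K"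
    and "finite C"
  shows "(\<lambda>w. of_int (\<Prod>c\<in>C. wwt i w - c) * x w) \<in> K"
  using \<open>finite C\<close>
proof induction
  case empty
  then show ?case using x by simp
next
  case (insert c C)
  let ?y = "\<lambda>w. of_int (\<Prod>c\<in>C. wwt i w - c) * x w"
  have lin: "lin_subspace K" using K(1) by (rule is_left_ideal_lin_subspace)
  have "(\<lambda>w. of_int (wwt i w) * ?y w) \<in> K"
    by (rule left_ideal_weight_op[OF K i insert.IH])
  moreover have "(\<lambda>w. of_int c * ?y w) \<in> K" using lin insert.IH by (auto simp: lin_subspace_def)
  ultimately have "(\<lambda>w. of_int (wwt i w) * ?y w - of_int c * ?y w) \<in> K"
    by (rule lin_subspace_diff[OF lin])
  then show ?case using insert by (simp add: algebra_simps)
qed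

text \<open>Lagrange interpolation: a polynomial in the weight operator that vanishes at all weights
  of \<open>x\<close> other than \<open>c\<close>, normalised to be 1 at \<open>c\<close>, is the
  projection to weight \<open>c\<close>.\<close>

lemma left_ideal_weight_component:
  assumes K: "is_left_ideal n K" "verma_left_ideal n \<mu> \<subseteq> K" and i: "1 \<le> i" "i \<le> n" and x: "x \<in> K"
  shows "(\<lambda>w. if wwt i w = c then x w else 0) \<in> K"
proof -
  let ?C = "wwt i ` {w. x w \<noteq> 0} - {c}"
  have lin: "lin_subspace K" using K(1) by (rule is_left_ideal_lin_subspace)
  have T: "x \<in> Talg n" using K x by (auto simp: is_left_ideal_def)
  have fin: "finite ?C" using Talg_finite[OF T] by simp
  define a where "a = (\<Prod>d\<in>?C. c - d)"
  have a: "a \<noteq> 0" using fin by (auto simp: a_def)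
  have "(\<lambda>w. inverse (of_int a) * (of_int (\<Prod>d\<in>?C. wwt i w - d) * x w)) \<in> K"
    using left_ideal_weight_poly[OF K i x fin] lin by (auto simp: lin_subspace_def)
  moreover have "inverse (of_int a) * (of_int (\<Prod>d\<in>?C. wwt i w - d) * x w)
      = (if wwt i w = c then x w else 0)" for w
  proof -
    have "(\<Prod>d\<in>?C. wwt i w - d) = 0" if "wwt i w \<noteq> c" "x w \<noteq> 0"
      by (rule prod_zero[OF fin]) (use that in auto)
    then show ?thesis using a unfolding a_def
      by (cases "x w = 0"; cases "wwt i w = c") (simp_all del: of_int_prod)
  qed
  ultimately show ?thesis by simp
qed

section \<open>Words of minimal weight and the functional dual to a negative simple root
  vector\<close>

lemma gwt_ge: "gwt i g \<ge> - 2"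
  by (cases g) (auto simp: hval_def)

lemma gwt_eq_minus_2: "gwt i g = - 2 \<longleftrightarrow> g = E (i+1) i"
  by (cases g) (auto simp: hval_def)

lemma wwt_ge: "wwt i w \<ge> - 2 * int (length w)"
proof (induction w)
  case (Cons g w)
  then show ?case using gwt_ge[of i g] by (simp add: wwt_def)
qed (simp add: wwt_def)

lemma wwt_minimal: "wwt i w = - 2 * int (length w) \<Longrightarrow> w = replicate (length w) (E (i+1) i)"
proof (induction w)
  case (Cons g w)
  have "gwt i g + wwt i w = - 2 - 2 * int (length w)" using Cons.prems by (simp add: wwt_def)
  then have "gwt i g = - 2" "wwt i w = - 2 * int (length w)"
    using gwt_ge[of i g] wwt_ge[of w i] by auto
  with Cons.IH show ?case by (simp add: gwt_eq_minus_2)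
qed simp

lemma length_le_tdeg:
  assumes "finite {w. x w \<noteq> 0}" "x w \<noteq> 0"
  shows "length w \<le> tdeg x"
proof -
  have "{length w | w. x w \<noteq> 0} = length ` {w. x w \<noteq> 0}" by auto
  then show ?thesis unfolding tdeg_def using assms by (intro Max_ge) auto
qed

text \<open>Applying \<open>E i (i+1)\<close> strips one factor at a time; the scalar that appears
  is invertible at every stage since \<open>\<mu> i\<close> is not a natural number.\<close>

lemma left_ideal_F_power_imp_tone:
  assumes K: "is_left_ideal n K" "verma_left_ideal n \<mu> \<subseteq> K" and i: "1 \<le> i" "i \<le> n"
    and \<mu>: "\<mu> i \<notin> \<nat>"
  shows "tmono (replicate N (E (i+1) i)) \<in> K \<Longrightarrow> tone \<in> K"
proof (induction N)
  case 0
  then show ?case by (simp add: tone_eq_tmono)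
next
  case (Suc N)
  let ?F = "\<lambda>N. replicate N (E (i+1) i)" and ?c = "of_nat (Suc N) * (of_rat (\<mu> i) - of_nat N) :: complex"
  have lin: "lin_subspace K" using K(1) by (rule is_left_ideal_lin_subspace)
  have "tmul (tmono [E i (i+1)]) (tmono (?F (Suc N))) \<in> K"
    using K(1) Suc.prems i unfolding is_left_ideal_def by (auto simp: tmono_in_Talg)
  then have "tmono (E i (i+1) # ?F (Suc N)) \<in> K" by (simp add: tmul_tmono)
  moreover have "(\<lambda>u. tmono (E i (i+1) # ?F (Suc N)) u - ?c * tmono (?F N) u) \<in> K"
    using E_F_power_in_verma[OF i] K(2) by blast
  ultimately have "(\<lambda>u. tmono (E i (i+1) # ?F (Suc N)) u
     - (tmono (E i (i+1) # ?F (Suc N)) u - ?c * tmono (?F N) u)) \<in> K"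
    by (rule lin_subspace_diff[OF lin])
  then have "(\<lambda>u. inverse ?c * (tmono (E i (i+1) # ?F (Suc N)) u
     - (tmono (E i (i+1) # ?F (Suc N)) u - ?c * tmono (?F N) u))) \<in> K"
    using lin by (auto simp: lin_subspace_def)
  moreover have "?c \<noteq> 0"
  proof -
    have "\<mu> i \<noteq> of_nat N" using \<mu> by auto
    then have "(of_rat (\<mu> i) :: complex) \<noteq> of_rat (of_nat N)" by (simp only: of_rat_eq_iff not_False_eq_True)
    then show ?thesis by (auto simp del: of_nat_Suc)
  qed
  moreover have "inverse c * (a - (a - c * b)) = b" if "c \<noteq> 0" for a b c :: complex
    using that by simp
  ultimately have "tmono (?F N) \<in> K" by (simp only: not_False_eq_True)
  then show ?case by (rule Suc.IH)
qed

definition dual_F :: "nat \<Rightarrow> gen \<Rightarrow> complex" where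
  "dual_F i g = (if g = E (i+1) i then 1 else 0)"

lemma prod_list_dual_F:
  "prod_list (map (dual_F i) w) = (if w = replicate (length w) (E (i+1) i) then 1 else 0)"
  by (induction w) (auto simp: dual_F_def)

lemma dual_F_in_assoc_variety:
  assumes i: "1 \<le> i" "i \<le> n" and \<mu>: "\<mu> i \<notin> \<nat>"
  shows "dual_F i \<in> assoc_variety n \<mu>"
proof -
  have "symbol_eval t (dual_F i) = 0" if t: "t \<in> annihilator n \<mu>" for t
  proof -
    let ?F = "replicate (tdeg t) (E (i+1) i)"
    have T: "t \<in> Talg n" using t by (simp add: annihilator_def)
    note fin = Talg_finite[OF T]
    have "tmul t tone \<in> simple_left_ideal n \<mu>"
      using t unfolding annihilator_def tone_eq_tmono by (auto simp: tmono_in_Talg)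
    \<comment> \<open>Membership in the union yields one proper left ideal, inside which the whole
      computation takes place.\<close>
    then obtain K where K: "is_left_ideal n K" "verma_left_ideal n \<mu> \<subseteq> K" "tone \<notin> K" "t \<in> K"
      by (auto simp: simple_left_ideal_def tmul_tone_right)
    have wt: "wwt i ?F = - 2 * int (tdeg t)"
      by (simp add: wwt_def sum_list_replicate hval_def)
    have "(\<lambda>w. if wwt i w = - 2 * int (tdeg t) then t w else 0) \<in> K"
      by (rule left_ideal_weight_component[OF K(1,2) i K(4)])
    moreover have "(if wwt i w = - 2 * int (tdeg t) then t w else 0) = t ?F * tmono ?F w" for w
    proof -
      have "w = ?F" if "wwt i w = - 2 * int (tdeg t)" "t w \<noteq> 0"
      proof -
        have "length w \<le> tdeg t" by (rule length_le_tdeg[OF fin that(2)])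
        with wwt_ge[of w i] that(1) have "length w = tdeg t" by simp
        with wwt_minimal[of i w] that(1) show ?thesis by simp
      qed
      then have "w \<noteq> ?F \<Longrightarrow> wwt i w = - 2 * int (tdeg t) \<Longrightarrow> t w = 0" by blast
      then show ?thesis using wt unfolding tmono_def by (cases "w = ?F") simp_all
    qed
    ultimately have inK: "(\<lambda>w. t ?F * tmono ?F w) \<in> K" by simp
    have tF: "t ?F = 0"
    proof (rule ccontr)
      assume nz: "t ?F \<noteq> 0"
      have "(\<lambda>w. inverse (t ?F) * (t ?F * tmono ?F w)) \<in> K"
        using inK K(1) unfolding is_left_ideal_def by fast
      with nz have "tmono ?F \<in> K" by (simp add: mult.assoc[symmetric])
      with left_ideal_F_power_imp_tone[OF K(1,2) i, of "tdeg t"] \<mu> K(3) show False by blast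
    qed
    \<comment> \<open>Among words of top length, \<open>dual_F i\<close> is nonzero only on the
      power \<open>?F\<close>, whose coefficient has just been shown to vanish.\<close>
    have "t w * prod_list (map (dual_F i) w) = 0" if "length w = tdeg t" for w
      using tF unfolding prod_list_dual_F that by (cases "w = ?F") simp_all
    then show ?thesis unfolding symbol_eval_def
      by (intro sum.neutral) blast
  qed
  moreover have "dual_F i a = 0" if "\<not> valid_gen n a" for a
    using that i by (auto simp: dual_F_def)
  ultimately show ?thesis by (simp add: assoc_variety_def)
qed

section \<open>Tensor powers of a matrix representation\<close>

text \<open>Sums over \<open>{1..n+1}\<close> are to stay whole rather than be split at the last
  index.\<close>

declare sum.cl_ivl_Suc [simp del]

text \<open>
  A function of \<open>w :: 'p \<Rightarrow> nat\<close> stands for a tensor in \<open>V\<^sup>\<otimes>\<^sup>D\<close> by its coordinates on the basis words \<open>w\<close>;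
  values of \<open>w\<close> outside \<open>D\<close> are inert parameters.
\<close>
definition act ::
  "nat \<Rightarrow> 'p set \<Rightarrow> (nat \<Rightarrow> nat \<Rightarrow> complex) \<Rightarrow> (('p \<Rightarrow> nat) \<Rightarrow> complex) \<Rightarrow> ('p \<Rightarrow> nat) \<Rightarrow> complex" where
  "act n D X f = (\<lambda>w. \<Sum>k\<in>D. \<Sum>c\<in>{1..n+1}. X (w k) c * f (w(k := c)))"

text \<open>The matrices \<open>A\<close> are a parameter so that one action serves the vector
  representation and its conjugates. With \<open>foldr\<close> the last letter acts first, as for
  composed operators.\<close>

definition wact ::
  "nat \<Rightarrow> 'p set \<Rightarrow> (gen \<Rightarrow> nat \<Rightarrow> nat \<Rightarrow> complex) \<Rightarrow> gen list
    \<Rightarrow> (('p \<Rightarrow> nat) \<Rightarrow> complex) \<Rightarrow> ('p \<Rightarrow> nat) \<Rightarrow> complex" where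
  "wact n D A u f = foldr (\<lambda>g. act n D (A g)) u f"

definition tact ::
  "nat \<Rightarrow> 'p set \<Rightarrow> (gen \<Rightarrow> nat \<Rightarrow> nat \<Rightarrow> complex) \<Rightarrow> telt
    \<Rightarrow> (('p \<Rightarrow> nat) \<Rightarrow> complex) \<Rightarrow> ('p \<Rightarrow> nat) \<Rightarrow> complex" where
  "tact n D A t f = (\<lambda>x. \<Sum>u | t u \<noteq> 0. t u * wact n D A u f x)"

lemma act_sum:
  "act n D X (\<lambda>x. \<Sum>s\<in>S. c s * f s x) = (\<lambda>x. \<Sum>s\<in>S. c s * act n D X (f s) x)"
proof
  fix x
  have "act n D X (\<lambda>x. \<Sum>s\<in>S. c s * f s x) x
    = (\<Sum>k\<in>D. \<Sum>e\<in>{1..n+1}. \<Sum>s\<in>S. c s * (X (x k) e * f s (x(k := e))))"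
    unfolding act_def sum_distrib_left by (simp add: algebra_simps)
  also have "\<dots> = (\<Sum>k\<in>D. \<Sum>s\<in>S. \<Sum>e\<in>{1..n+1}. c s * (X (x k) e * f s (x(k := e))))"
    by (intro sum.cong refl) (rule sum.swap)
  also have "\<dots> = (\<Sum>s\<in>S. \<Sum>k\<in>D. \<Sum>e\<in>{1..n+1}. c s * (X (x k) e * f s (x(k := e))))"
    by (rule sum.swap)
  finally show "act n D X (\<lambda>x. \<Sum>s\<in>S. c s * f s x) x = (\<Sum>s\<in>S. c s * act n D X (f s) x)"
    by (simp add: act_def sum_distrib_left)
qed

lemma act_zero: "act n D X (\<lambda>_. 0) = (\<lambda>_. 0)"
  by (simp add: act_def)

text \<open>Columns are restricted to the range of the inner sum, rows are not, because the letter
  \<open>w k\<close> is arbitrary. The axiom of \<open>mat_rep\<close> has the same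
  asymmetry.\<close>

lemma act_mat_sum:
  assumes "\<And>r s. s \<in> {1..n+1} \<Longrightarrow> X r s = (\<Sum>g\<in>G. c g * Y g r s)"
  shows "act n D X f x = (\<Sum>g\<in>G. c g * act n D (Y g) f x)"
proof -
  have "act n D X f x = (\<Sum>k\<in>D. \<Sum>e\<in>{1..n+1}. \<Sum>g\<in>G. c g * (Y g (x k) e * f (x(k := e))))"
    unfolding act_def by (intro sum.cong refl) (simp only: assms sum_distrib_right mult.assoc)
  also have "\<dots> = (\<Sum>k\<in>D. \<Sum>g\<in>G. \<Sum>e\<in>{1..n+1}. c g * (Y g (x k) e * f (x(k := e))))"
    by (intro sum.cong refl) (rule sum.swap)
  also have "\<dots> = (\<Sum>g\<in>G. \<Sum>k\<in>D. \<Sum>e\<in>{1..n+1}. c g * (Y g (x k) e * f (x(k := e))))"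
    by (rule sum.swap)
  finally show ?thesis by (simp add: act_def sum_distrib_left)
qed

text \<open>Operators on different tensor factors commute, so only the terms with both matrices on
  the same factor survive.\<close>

lemma act_commutator:
  assumes "finite D"
  shows "act n D X (act n D Y f) x - act n D Y (act n D X f) x
    = act n D (\<lambda>r s. \<Sum>t\<in>{1..n+1}. X r t * Y t s - Y r t * X t s) f x"
proof -
  define G where "G X Y k l = (\<Sum>c\<in>{1..n+1}. \<Sum>e\<in>{1..n+1}.
      X (x k) c * Y ((x(k := c)) l) e * f (x(k := c, l := e)))"
    for X Y :: "nat \<Rightarrow> nat \<Rightarrow> complex" and k l
  have expand: "act n D X (act n D Y f) x = (\<Sum>k\<in>D. \<Sum>l\<in>D. G X Y k l)" for X Y
  proof -
    have "act n D X (act n D Y f) x = (\<Sum>k\<in>D. \<Sum>c\<in>{1..n+1}. \<Sum>l\<in>D. \<Sum>e\<in>{1..n+1}.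
      X (x k) c * Y ((x(k := c)) l) e * f (x(k := c, l := e)))"
      by (simp add: act_def sum_distrib_left mult.assoc)
    also have "\<dots> = (\<Sum>k\<in>D. \<Sum>l\<in>D. G X Y k l)"
      unfolding G_def by (intro sum.cong refl) (rule sum.swap)
    finally show ?thesis .
  qed
  have off: "G X Y k l = G Y X l k" if "k \<noteq> l" for k l
    unfolding G_def by (subst sum.swap) (use that in \<open>simp add: fun_upd_twist mult.commute\<close>)
  have diag: "G X Y k k = (\<Sum>e\<in>{1..n+1}. (\<Sum>c\<in>{1..n+1}. X (x k) c * Y c e) * f (x(k := e)))" for X Y k
    unfolding G_def by (subst sum.swap) (simp add: sum_distrib_right)
  have "act n D X (act n D Y f) x - act n D Y (act n D X f) x
     = (\<Sum>k\<in>D. \<Sum>l\<in>D. G X Y k l) - (\<Sum>k\<in>D. \<Sum>l\<in>D. G Y X l k)"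
    unfolding expand by (subst (4) sum.swap) simp
  also have "\<dots> = (\<Sum>k\<in>D. \<Sum>l\<in>D. if l = k then G X Y k k - G Y X k k else 0)"
    unfolding sum_subtractf[symmetric] by (intro sum.cong refl) (auto simp: off)
  also have "\<dots> = (\<Sum>k\<in>D. G X Y k k - G Y X k k)" using assms by simp
  also have "\<dots> = act n D (\<lambda>r s. \<Sum>t\<in>{1..n+1}. X r t * Y t s - Y r t * X t s) f x"
    unfolding diag act_def sum_subtractf[symmetric] left_diff_distrib[symmetric] ..
  finally show ?thesis .
qed

lemma wact_Nil: "wact n D A [] f = f"
  by (simp add: wact_def)

lemma wact_Cons: "wact n D A (g # u) f = act n D (A g) (wact n D A u f)"
  by (simp add: wact_def)

lemma wact_append: "wact n D A (u @ v) f = wact n D A u (wact n D A v f)"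
  by (simp add: wact_def)

lemma wact_sum:
  "wact n D A u (\<lambda>x. \<Sum>s\<in>S. c s * f s x) = (\<lambda>x. \<Sum>s\<in>S. c s * wact n D A u (f s) x)"
  by (induction u) (simp_all add: wact_Nil wact_Cons act_sum)

lemma wact_zero: "wact n D A u (\<lambda>_. 0) = (\<lambda>_. 0)"
  by (induction u) (simp_all add: wact_Nil wact_Cons act_zero)

lemma tact_zero: "tact n D A t (\<lambda>_. 0) = (\<lambda>_. 0)"
  by (simp add: tact_def wact_zero)

lemma tact_zero_left: "tact n D A (\<lambda>_. 0) f = (\<lambda>_. 0)"
  by (simp add: tact_def)

lemma tact_superset:
  assumes "finite S" "{u. t u \<noteq> 0} \<subseteq> S"
  shows "tact n D A t f x = (\<Sum>u\<in>S. t u * wact n D A u f x)"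
  unfolding tact_def by (rule sum.mono_neutral_left) (use assms in auto)

lemma tact_tmono: "tact n D A (tmono u) f = wact n D A u f"
proof
  fix x
  show "tact n D A (tmono u) f x = wact n D A u f x"
    by (subst tact_superset[where S = "{u}"]) (auto simp: tmono_def)
qed

lemma tact_add:
  assumes "s \<in> Talg m" "t \<in> Talg m"
  shows "tact n D A (\<lambda>w. s w + t w) f = (\<lambda>x. tact n D A s f x + tact n D A t f x)"
proof
  fix x
  let ?S = "{u. s u \<noteq> 0} \<union> {u. t u \<noteq> 0}"
  have fin: "finite ?S" using assms by (simp add: Talg_finite)
  show "tact n D A (\<lambda>w. s w + t w) f x = tact n D A s f x + tact n D A t f x"
    by (subst (1 2 3) tact_superset[OF fin]) (auto simp: sum.distrib[symmetric] algebra_simps)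
qed

lemma tact_smult: "tact n D A (\<lambda>w. c * t w) f = (\<lambda>x. c * tact n D A t f x)"
  by (cases "c = 0") (simp_all add: tact_def sum_distrib_left mult.assoc)

lemma tact_diff:
  assumes "s \<in> Talg m" "t \<in> Talg m"
  shows "tact n D A (\<lambda>w. s w - t w) f = (\<lambda>x. tact n D A s f x - tact n D A t f x)"
  using tact_add[OF assms(1) smult_in_Talg[OF assms(2), of "-1"], of n D A f]
    tact_smult[of n D A "-1" t f] by simp

lemma tact_tmul:
  assumes "s \<in> Talg m" "t \<in> Talg m"
  shows "tact n D A (tmul s t) f = tact n D A s (tact n D A t f)"
proof
  fix x
  let ?S = "{u. s u \<noteq> 0}" and ?T = "{u. t u \<noteq> 0}"
  let ?P = "?S \<times> ?T" and ?m = "\<lambda>p. fst p @ snd p :: gen list"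
  have fin: "finite ?S" "finite ?T" "finite ?P" using assms by (auto simp: Talg_finite)
  have supp: "{w. tmul s t w \<noteq> 0} \<subseteq> ?m ` ?P"
  proof
    fix w assume "w \<in> {w. tmul s t w \<noteq> 0}"
    then obtain u v where "w = u @ v" "s u \<noteq> 0" "t v \<noteq> 0" by (auto elim: tmul_nonzeroD)
    then show "w \<in> ?m ` ?P" by (intro image_eqI[where x = "(u, v)"]) auto
  qed
  have tm: "tmul s t w = (\<Sum>p\<in>{p \<in> ?P. ?m p = w}. s (fst p) * t (snd p))" for w
    unfolding tmul_eq_sum_splits by (rule sum.mono_neutral_right) (auto simp: finite_splits)
  have "tact n D A (tmul s t) f x = (\<Sum>w\<in>?m ` ?P. tmul s t w * wact n D A w f x)"
    by (rule tact_superset[OF finite_imageI[OF fin(3)] supp])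
  also have "\<dots> = (\<Sum>w\<in>?m ` ?P. \<Sum>p\<in>{p \<in> ?P. ?m p = w}.
      s (fst p) * t (snd p) * wact n D A (?m p) f x)"
    unfolding tm sum_distrib_right by (intro sum.cong) auto
  \<comment> \<open>The fibres of concatenation partition the pairs of words, so the double sum runs
    once over all pairs.\<close>
  also have "\<dots> = (\<Sum>p\<in>?P. s (fst p) * t (snd p) * wact n D A (?m p) f x)"
    by (rule sum.group) (use fin in auto)
  also have "\<dots> = (\<Sum>u\<in>?S. \<Sum>v\<in>?T. s u * t v * wact n D A (u @ v) f x)"
    by (simp add: sum.cartesian_product split_def)
  also have "\<dots> = tact n D A s (tact n D A t f) x"
    unfolding tact_def wact_append wact_sum by (simp add: sum_distrib_left mult.assoc)
  finally show "tact n D A (tmul s t) f x = tact n D A s (tact n D A t f) x" .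
qed

lemma tact_linear_factor:
  assumes "valid_gen n a"
  shows "tact n D A (\<lambda>w. tgen a w - tconst c w) f = (\<lambda>x. act n D (A a) f x - c * f x)"
proof -
  have c: "tconst c = (\<lambda>w. c * tmono [] w)" by (auto simp: tconst_def tmono_def)
  have "tact n D A (\<lambda>w. tgen a w - tconst c w) f
     = (\<lambda>x. tact n D A (tmono [a]) f x - tact n D A (tconst c) f x)"
    unfolding tgen_eq_tmono
    by (rule tact_diff[of _ n]) (use assms in \<open>auto intro: tmono_in_Talg tconst_in_Talg\<close>)
  then show ?thesis unfolding c tact_smult tact_tmono by (simp add: wact_Nil wact_Cons)
qed

section \<open>Matrix representations: annihilators and reduced elements\<close>

locale mat_rep =
  fixes n :: nat and A :: "gen \<Rightarrow> nat \<Rightarrow> nat \<Rightarrow> complex"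
  assumes A_comm: "valid_gen n a \<Longrightarrow> valid_gen n b \<Longrightarrow> s \<in> {1..n+1} \<Longrightarrow>
    (\<Sum>t\<in>{1..n+1}. A a r t * A b t s - A b r t * A a t s)
      = (\<Sum>g | valid_gen n g. coord (comm_mat n a b) g * A g r s)"
begin

lemma tact_trel:
  assumes "finite D" "valid_gen n a" "valid_gen n b"
  shows "tact n D A (trel n a b) f = (\<lambda>_. 0)"
proof
  fix x
  have br: "tact n D A (tbracket n a b) f x
      = (\<Sum>g | valid_gen n g. coord (comm_mat n a b) g * act n D (A g) f x)"
  proof -
    have "tact n D A (tbracket n a b) f x
      = (\<Sum>u\<in>(\<lambda>g. [g]) ` {g. valid_gen n g}. tbracket n a b u * wact n D A u f x)"
      by (intro tact_superset tbracket_support) (simp add: finite_gens)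
    also have "\<dots> = (\<Sum>g | valid_gen n g. tbracket n a b [g] * wact n D A [g] f x)"
      by (subst sum.reindex) (auto simp: inj_on_def)
    also have "\<dots> = (\<Sum>g | valid_gen n g. coord (comm_mat n a b) g * act n D (A g) f x)"
      by (intro sum.cong refl) (simp add: tbracket_def wact_Nil wact_Cons)
    finally show ?thesis .
  qed
  have mono: "tmono [a, b] \<in> Talg n" "tmono [b, a] \<in> Talg n"
    using assms by (auto intro: tmono_in_Talg)
  have "tact n D A (trel n a b) f x
     = wact n D A [a, b] f x - wact n D A [b, a] f x - tact n D A (tbracket n a b) f x"
    unfolding trel_def tgen_eq_tmono tmul_tmono
    by (simp add: tact_diff[OF diff_in_Talg[OF mono] tbracket_in_Talg] tact_diff[OF mono] tact_tmono)
  also have "\<dots> = act n D (\<lambda>r s. \<Sum>t\<in>{1..n+1}. A a r t * A b t s - A b r t * A a t s) f x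
      - (\<Sum>g | valid_gen n g. coord (comm_mat n a b) g * act n D (A g) f x)"
    unfolding act_commutator[OF assms(1), symmetric] br by (simp add: wact_Nil wact_Cons)
  also have "\<dots> = 0"
    by (simp only: act_mat_sum[OF A_comm[OF assms(2,3)]] diff_self)
  finally show "tact n D A (trel n a b) f x = 0" .
qed

lemma tact_IU:
  assumes "finite D" "x \<in> IU n"
  shows "tact n D A x f = (\<lambda>_. 0)"
proof -
  \<comment> \<open>Right multiplication changes the vector, so \<open>f\<close> is quantified;
    membership in \<open>Talg n\<close> is carried along for the additivity and multiplicativity of
    \<open>tact\<close>.\<close>
  have "x \<in> Talg n \<and> (\<forall>f. tact n D A x f = (\<lambda>_. 0))"
    using assms(2) unfolding IU_def
  proof induction
    case (base x)
    then show ?case using assms(1) by (auto simp: tact_trel trel_in_Talg)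
  qed (auto simp: zero_in_Talg add_in_Talg smult_in_Talg tmul_in_Talg tact_add tact_smult
      tact_tmul[of _ n] tact_zero tact_zero_left)
  then show ?thesis by blast
qed

text \<open>The elements killing \<open>v\<close> form a proper left ideal containing the Verma
  ideal. Since \<open>u\<close> kills every vector, \<open>u y\<close> kills \<open>v\<close> for
  all \<open>y\<close>.\<close>

lemma annihilator_highest_weight:
  assumes D: "finite D"
    and E: "\<And>i j. valid_gen n (E i j) \<Longrightarrow> i < j \<Longrightarrow> act n D (A (E i j)) v = (\<lambda>_. 0)"
    and H: "\<And>i. 1 \<le> i \<Longrightarrow> i \<le> n \<Longrightarrow> act n D (A (H i)) v = (\<lambda>x. of_rat (\<mu> i) * v x)"
    and v: "v \<noteq> (\<lambda>_. 0)"
    and u: "u \<in> Talg n" "\<And>f. tact n D A u f = (\<lambda>_. 0)"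
  shows "u \<in> annihilator n \<mu>"
proof -
  define K where "K = {t \<in> Talg n. tact n D A t v = (\<lambda>_. 0)}"
  have ideal: "is_left_ideal n K"
    unfolding is_left_ideal_def K_def
    by (auto simp: zero_in_Talg add_in_Talg smult_in_Talg tmul_in_Talg tact_add tact_smult
      tact_tmul[of _ n] tact_zero tact_zero_left)
  have "x \<in> K" if "x \<in> verma_left_ideal n \<mu>" for x
    using that unfolding verma_left_ideal_def
  proof induction
    case (base x)
    then consider "x \<in> IU n" | i j where "x = tgen (E i j)" "valid_gen n (E i j)" "i < j"
      | i where "x = (\<lambda>w. tgen (H i) w - tconst (of_rat (\<mu> i)) w)" "1 \<le> i" "i \<le> n"
      by blast
    then show ?case
    proof cases
      case 1
      then show ?thesis using IU_subset_Talg tact_IU[OF D] by (auto simp: K_def)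
    next
      case 2
      then show ?thesis
        using E[OF 2(2,3)] unfolding K_def tgen_eq_tmono
        by (auto simp: tact_tmono wact_Nil wact_Cons intro: tmono_in_Talg)
    next
      case 3
      then have "x \<in> Talg n" unfolding 3 tgen_eq_tmono
        by (intro diff_in_Talg tmono_in_Talg tconst_in_Talg) auto
      then show ?thesis
        using 3 H[OF 3(2,3)] tact_linear_factor[of n "H i" D A "of_rat (\<mu> i)" v] by (simp add: K_def)
    qed
  next
    case zero
    then show ?case using ideal by (simp add: is_left_ideal_def)
  next
    case (add x y)
    then show ?case using ideal unfolding is_left_ideal_def by blast
  next
    case (smul x c)
    then show ?case using ideal unfolding is_left_ideal_def by blast
  next
    case (lmul y x)
    then show ?case using ideal unfolding is_left_ideal_def by blast
  qed
  moreover have "tone \<notin> K" using v by (simp add: K_def tone_eq_tmono tact_tmono wact_Nil)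
  ultimately have "K \<subseteq> simple_left_ideal n \<mu>"
    unfolding simple_left_ideal_def using ideal by blast
  moreover have "tmul u y \<in> K" if "y \<in> Talg n" for y
    using u that by (simp add: K_def tmul_in_Talg tact_tmul[of _ n])
  ultimately show ?thesis unfolding annihilator_def using u(1) by blast
qed

text \<open>
  The coefficient of \<open>u\<close> from the constant word \<open>j\<close> to a word \<open>w\<close>: every letter of \<open>u\<close> changes at most one
  tensor factor.
\<close>
lemma wact_delta:
  fixes D :: "'p set"
  assumes D: "finite D" and ij: "i \<noteq> j" "j \<in> {1..n+1}"
  defines "f \<equiv> (\<lambda>w :: 'p \<Rightarrow> nat. if \<forall>k\<in>D. w k = j then 1 else 0)"
  shows "(card {k\<in>D. w k \<noteq> j} > length u \<longrightarrow> wact n D A u f w = 0) \<and>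
    (card {k\<in>D. w k \<noteq> j} = length u \<longrightarrow> (\<forall>k\<in>D. w k = i \<or> w k = j) \<longrightarrow>
      wact n D A u f w = fact (length u) * prod_list (map (\<lambda>g. A g i j) u))"
proof (induction u arbitrary: w)
  case Nil
  have "card {k\<in>D. w k \<noteq> j} = 0 \<longleftrightarrow> (\<forall>k\<in>D. w k = j)" using D by auto
  then show ?case unfolding wact_Nil f_def by (cases "\<forall>k\<in>D. w k = j") simp_all
next
  case (Cons g u)
  let ?N = "\<lambda>w. {k\<in>D. w k \<noteq> j}"
  have step: "wact n D A (g # u) f w = (\<Sum>k\<in>?N w. A g (w k) j * wact n D A u f (w(k := j)))"
    if big: "card (?N w) \<ge> Suc (length u)"
  proof -
    have "(\<Sum>c\<in>{1..n+1}. A g (w k) c * wact n D A u f (w(k := c)))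
        = (if k \<in> ?N w then A g (w k) j * wact n D A u f (w(k := j)) else 0)" if k: "k \<in> D" for k
    proof -
      \<comment> \<open>Only turning a letter different from \<open>j\<close> into \<open>j\<close>
        brings the word closer to the constant word; any other choice leaves too many differing
        positions for the letters of \<open>u\<close>.\<close>
      have van: "wact n D A u f (w(k := c)) = 0" if "c \<noteq> j \<or> w k = j" for c
      proof -
        have "?N w \<subseteq> ?N (w(k := c))" using that k by auto
        then have "card (?N w) \<le> card (?N (w(k := c)))" using D by (intro card_mono) auto
        then have "length u < card (?N (w(k := c)))" using big by linarith
        then show ?thesis using Cons.IH[of "w(k := c)"] by blast
      qed
      have "(\<Sum>c\<in>{1..n+1}. A g (w k) c * wact n D A u f (w(k := c)))
        = (\<Sum>c\<in>{1..n+1}. if c = j then A g (w k) j * wact n D A u f (w(k := j)) else 0)"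
        by (intro sum.cong) (auto simp: van)
      also have "\<dots> = A g (w k) j * wact n D A u f (w(k := j))" using ij by simp
      finally show ?thesis using van[of j] k by auto
    qed
    then have "wact n D A (g # u) f w
        = (\<Sum>k\<in>D. if k \<in> ?N w then A g (w k) j * wact n D A u f (w(k := j)) else 0)"
      unfolding wact_Cons act_def by (intro sum.cong) auto
    also have "\<dots> = (\<Sum>k\<in>?N w. A g (w k) j * wact n D A u f (w(k := j)))"
      by (rule sum.mono_neutral_cong_right) (use D in auto)
    finally show ?thesis .
  qed
  have card_upd: "card (?N (w(k := j))) = card (?N w) - 1" if "k \<in> ?N w" for k
  proof -
    have "?N (w(k := j)) = ?N w - {k}" by auto
    then show ?thesis using that by simp
  qed
  show ?case
  proof (intro conjI impI)
    assume big: "length (g # u) < card (?N w)"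
    have "wact n D A u f (w(k := j)) = 0" if "k \<in> ?N w" for k
    proof -
      have "length u < card (?N (w(k := j)))" unfolding card_upd[OF that] using big by simp
      then show ?thesis using Cons.IH[of "w(k := j)"] by blast
    qed
    then show "wact n D A (g # u) f w = 0" using step big by simp
  next
    assume eq: "card (?N w) = length (g # u)" and w: "\<forall>k\<in>D. w k = i \<or> w k = j"
    have "A g (w k) j * wact n D A u f (w(k := j))
        = A g i j * (fact (length u) * prod_list (map (\<lambda>g. A g i j) u))" if "k \<in> ?N w" for k
    proof -
      have "card (?N (w(k := j))) = length u" unfolding card_upd[OF that] using eq by simp
      moreover have "\<forall>l\<in>D. (w(k := j)) l = i \<or> (w(k := j)) l = j" using w by simp
      ultimately have "wact n D A u f (w(k := j)) = fact (length u) * prod_list (map (\<lambda>g. A g i j) u)"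
        using Cons.IH[of "w(k := j)"] by blast
      moreover have "w k = i" using that w by auto
      ultimately show ?thesis by simp
    qed
    then have "(\<Sum>k\<in>?N w. A g (w k) j * wact n D A u f (w(k := j)))
       = (\<Sum>k\<in>?N w. A g i j * (fact (length u) * prod_list (map (\<lambda>g. A g i j) u)))"
      by (rule sum.cong[OF refl])
    with step eq have "wact n D A (g # u) f w
       = (\<Sum>k\<in>?N w. A g i j * (fact (length u) * prod_list (map (\<lambda>g. A g i j) u)))"
      by (simp only: length_Cons order_refl)
    \<comment> \<open>The first letter may act at any of the \<open>length (g # u)\<close> differing
      positions with the same outcome, which supplies the next factor of the factorial.\<close>
    then show "wact n D A (g # u) f w
        = fact (length (g # u)) * prod_list (map (\<lambda>g. A g i j) (g # u))"
      using eq by (simp only: sum_constant) (simp add: algebra_simps)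
  qed
qed

text \<open>The coefficient from the constant word \<open>j\<close> to the constant word
  \<open>i\<close> is \<open>tdeg t\<close> factorial times the symbol at the point of entries
  \<open>A g i j\<close>. It is unchanged modulo \<open>IU n\<close> but vanishes in smaller
  degree.\<close>

lemma reduced_if_symbol_nonzero:
  assumes t: "t \<in> Talg n" and ij: "i \<noteq> j" "j \<in> {1..n+1}"
    and nz: "symbol_eval t (\<lambda>g. A g i j) \<noteq> 0"
  shows "reduced n t"
  unfolding reduced_def
proof (intro ballI impI, rule ccontr)
  fix s assume s: "s \<in> Talg n" and st: "(\<lambda>w. s w - t w) \<in> IU n" and less: "\<not> tdeg t \<le> tdeg s"
  \<comment> \<open>As many tensor factors as the degree of \<open>t\<close>: just enough that only
    words of top length can change them all.\<close>
  let ?D = "{..<tdeg t}"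
  define f where "f = (\<lambda>w :: nat \<Rightarrow> nat. if \<forall>k\<in>?D. w k = j then 1 else 0 :: complex)"
  have card: "card {k\<in>?D. i \<noteq> j} = tdeg t" using ij by simp
  note delta = wact_delta[where D = ?D and i = i and j = j and w = "\<lambda>_. i", OF finite_lessThan ij,
    folded f_def, unfolded card]
  have "tact n ?D A s f (\<lambda>_. i) = 0"
    unfolding tact_def
  proof (rule sum.neutral, rule ballI)
    fix u assume "u \<in> {u. s u \<noteq> 0}"
    then have "length u \<le> tdeg s" using length_le_tdeg[OF Talg_finite[OF s]] by simp
    then show "s u * wact n ?D A u f (\<lambda>_. i) = 0" using less delta[of u] by simp
  qed
  moreover have "tact n ?D A t f (\<lambda>_. i) = fact (tdeg t) * symbol_eval t (\<lambda>g. A g i j)"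
  proof -
    have "tact n ?D A t f (\<lambda>_. i) = (\<Sum>u | t u \<noteq> 0 \<and> length u = tdeg t. t u * wact n ?D A u f (\<lambda>_. i))"
      unfolding tact_def
    proof (rule sum.mono_neutral_right)
      show "\<forall>u\<in>{u. t u \<noteq> 0} - {u. t u \<noteq> 0 \<and> length u = tdeg t}. t u * wact n ?D A u f (\<lambda>_. i) = 0"
        using delta length_le_tdeg[OF Talg_finite[OF t]] by (auto simp: le_less)
    qed (use Talg_finite[OF t] in auto)
    also have "\<dots> = fact (tdeg t) * symbol_eval t (\<lambda>g. A g i j)"
    proof -
      have "wact n ?D A u f (\<lambda>_. i) = fact (tdeg t) * prod_list (map (\<lambda>g. A g i j) u)"
        if "length u = tdeg t" for u
      proof -
        have "tdeg t = length u \<longrightarrow>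
            wact n ?D A u f (\<lambda>_. i) = fact (length u) * prod_list (map (\<lambda>g. A g i j) u)"
          using delta[of u] by blast
        then show ?thesis unfolding that by blast
      qed
      then show ?thesis unfolding symbol_eval_def sum_distrib_left
        by (intro sum.cong refl) simp
    qed
    finally show ?thesis .
  qed
  moreover have "tact n ?D A s f (\<lambda>_. i) - tact n ?D A t f (\<lambda>_. i) = 0"
    using tact_IU[OF finite_lessThan st] tact_diff[OF s t] by metis
  ultimately show False using nz by simp
qed

end

section \<open>The vector representation and reduced polynomials in one generator\<close>

lemma gmat_support: "valid_gen n g \<Longrightarrow> gmat g r s \<noteq> 0 \<Longrightarrow> r \<in> {1..n+1} \<and> s \<in> {1..n+1}"
  by (cases g) (auto split: if_splits)

lemma comm_mat_trace: "(\<Sum>r\<in>{1..n+1}. comm_mat n a b r r) = 0"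
proof -
  have "(\<Sum>r\<in>{1..n+1}. \<Sum>t\<in>{1..n+1}. gmat b r t * gmat a t r)
      = (\<Sum>r\<in>{1..n+1}. \<Sum>t\<in>{1..n+1}. gmat a r t * gmat b t r)"
    by (subst sum.swap) (simp only: mult.commute)
  then show ?thesis unfolding comm_mat_def sum_subtractf by simp
qed

lemma sum_coord_gmat:
  assumes supp: "\<And>r s. X r s \<noteq> 0 \<Longrightarrow> r \<in> {1..n+1} \<and> s \<in> {1..n+1}"
    and tr: "(\<Sum>r\<in>{1..n+1}. X r r) = 0"
  shows "(\<Sum>g | valid_gen n g. coord X g * gmat g r s) = X r s"
proof (cases "r = s")
  case False
  have "(\<Sum>g | valid_gen n g. coord X g * gmat g r s)
      = (\<Sum>g | valid_gen n g. if g = E r s then X r s else 0)"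
  proof (intro sum.cong refl)
    fix g
    show "coord X g * gmat g r s = (if g = E r s then X r s else 0)"
      using False by (cases g) auto
  qed
  also have "\<dots> = (if valid_gen n (E r s) then X r s else 0)"
    using finite_gens[of n] by simp
  also have "\<dots> = X r s" using supp[of r s] False by auto
  finally show ?thesis .
next
  case True
  define S where "S i = (\<Sum>q\<in>{1..i}. X q q)" for i
  have S: "S (Suc i) = S i + X (Suc i) (Suc i)" "S 0 = 0" for i
    by (simp_all add: S_def sum.cl_ivl_Suc)
  have trS: "S (n + 1) = 0" using tr by (simp add: S_def)
  have "(\<Sum>g | valid_gen n g. coord X g * gmat g r s) = (\<Sum>g\<in>H ` {1..n}. coord X g * gmat g r s)"
  proof (rule sum.mono_neutral_right)
    show "\<forall>g\<in>{g. valid_gen n g} - H ` {1..n}. coord X g * gmat g r s = 0"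
    proof
      fix g assume "g \<in> {g. valid_gen n g} - H ` {1..n}"
      then show "coord X g * gmat g r s = 0" using True by (cases g) auto
    qed
  qed (auto simp: finite_gens)
  also have "\<dots> = (\<Sum>i\<in>{1..n}. S i * gmat (H i) r r)"
    using True by (subst sum.reindex) (auto simp: inj_on_def S_def)
  \<comment> \<open>Only \<open>H r\<close> and \<open>H (r - 1)\<close> meet the diagonal position
    \<open>r\<close>, leaving the difference \<open>S r - S (r - 1)\<close>.\<close>
  also have "\<dots> = (\<Sum>i\<in>{1..n}. if i = r then S r else 0) - (\<Sum>i\<in>{1..n}. if i = r - 1 then S (r - 1) else 0)"
    unfolding sum_subtractf[symmetric] by (intro sum.cong) auto
  also have "\<dots> = X r r"
  proof -
    \<comment> \<open>At \<open>r = n + 1\<close> there is no \<open>H r\<close>, and the missing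
      term \<open>S (n + 1)\<close> is the trace, hence 0. The first two cases lie outside the
      support.\<close>
    consider "r = 0" | "r > n + 1" | "r = n + 1" | m where "r = Suc m" "m < n"
      by (cases r) (auto simp: le_less, linarith)
    then show ?thesis
    proof cases
      case 3
      then show ?thesis using trS S(1)[of n] S(2) by (cases "n = 0") (auto simp: add_eq_0_iff)
    next
      case 4
      then show ?thesis using S(1)[of m] S(2) by (cases "m = 0") auto
    qed (use supp[of r r] in auto)
  qed
  finally show ?thesis using True by simp
qed

lemma comm_mat_support:
  assumes "valid_gen n a" "valid_gen n b" "comm_mat n a b r s \<noteq> 0"
  shows "r \<in> {1..n+1} \<and> s \<in> {1..n+1}"
proof -
  obtain t where "gmat a r t * gmat b t s - gmat b r t * gmat a t s \<noteq> 0"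
    using assms(3) unfolding comm_mat_def by (rule sum.not_neutral_contains_not_neutral)
  then have "gmat a r t \<noteq> 0 \<and> gmat b t s \<noteq> 0 \<or> gmat b r t \<noteq> 0 \<and> gmat a t s \<noteq> 0" by auto
  then show ?thesis using gmat_support assms(1,2) by blast
qed

lemma comm_mat_eq_sum:
  assumes "valid_gen n a" "valid_gen n b"
  shows "comm_mat n a b r s = (\<Sum>g | valid_gen n g. coord (comm_mat n a b) g * gmat g r s)"
  by (rule sum_coord_gmat[symmetric]) (use comm_mat_support[OF assms] comm_mat_trace in blast)+

lemma mat_rep_gmat: "mat_rep n gmat"
proof
  fix a b r s assume ab: "valid_gen n a" "valid_gen n b"
  show "(\<Sum>t\<in>{1..n+1}. gmat a r t * gmat b t s - gmat b r t * gmat a t s)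
      = (\<Sum>g | valid_gen n g. coord (comm_mat n a b) g * gmat g r s)"
    unfolding comm_mat_eq_sum[OF ab, symmetric] by (simp only: comm_mat_def)
qed

section \<open>Conjugates of the vector representation\<close>

definition mm :: "nat \<Rightarrow> (nat \<Rightarrow> nat \<Rightarrow> complex) \<Rightarrow> (nat \<Rightarrow> nat \<Rightarrow> complex) \<Rightarrow> nat \<Rightarrow> nat \<Rightarrow> complex" where
  "mm n X Y r s = (\<Sum>t\<in>{1..n+1}. X r t * Y t s)"

lemma mm_assoc: "mm n (mm n X Y) Z = mm n X (mm n Y Z)"
proof (intro ext)
  fix r s
  have "mm n (mm n X Y) Z r s = (\<Sum>t\<in>{1..n+1}. \<Sum>u\<in>{1..n+1}. X r u * (Y u t * Z t s))"
    by (simp add: mm_def sum_distrib_right mult.assoc)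
  also have "\<dots> = mm n X (mm n Y Z) r s"
    unfolding mm_def sum_distrib_left by (rule sum.swap)
  finally show "mm n (mm n X Y) Z r s = mm n X (mm n Y Z) r s" .
qed

lemma mm_sum_left: "mm n (\<lambda>r s. \<Sum>g\<in>G. c g * Y g r s) Z = (\<lambda>r s. \<Sum>g\<in>G. c g * mm n (Y g) Z r s)"
proof (intro ext)
  fix r s
  have "mm n (\<lambda>r s. \<Sum>g\<in>G. c g * Y g r s) Z r s
      = (\<Sum>t\<in>{1..n+1}. \<Sum>g\<in>G. c g * (Y g r t * Z t s))"
    by (simp add: mm_def sum_distrib_right mult.assoc)
  also have "\<dots> = (\<Sum>g\<in>G. c g * mm n (Y g) Z r s)"
    unfolding mm_def sum_distrib_left by (rule sum.swap)
  finally show "mm n (\<lambda>r s. \<Sum>g\<in>G. c g * Y g r s) Z r s = (\<Sum>g\<in>G. c g * mm n (Y g) Z r s)" .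
qed

lemma mm_sum_right: "mm n Z (\<lambda>r s. \<Sum>g\<in>G. c g * Y g r s) = (\<lambda>r s. \<Sum>g\<in>G. c g * mm n Z (Y g) r s)"
proof (intro ext)
  fix r s
  have "mm n Z (\<lambda>r s. \<Sum>g\<in>G. c g * Y g r s) r s
      = (\<Sum>t\<in>{1..n+1}. \<Sum>g\<in>G. c g * (Z r t * Y g t s))"
    by (simp add: mm_def sum_distrib_left algebra_simps)
  also have "\<dots> = (\<Sum>g\<in>G. c g * mm n Z (Y g) r s)"
    unfolding mm_def sum_distrib_left by (rule sum.swap)
  finally show "mm n Z (\<lambda>r s. \<Sum>g\<in>G. c g * Y g r s) r s = (\<Sum>g\<in>G. c g * mm n Z (Y g) r s)" .
qed

lemma mm_diff_left: "mm n (\<lambda>r s. X r s - Y r s) Z = (\<lambda>r s. mm n X Z r s - mm n Y Z r s)"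
  by (simp add: fun_eq_iff mm_def left_diff_distrib sum_subtractf)

lemma mm_diff_right: "mm n Z (\<lambda>r s. X r s - Y r s) = (\<lambda>r s. mm n Z X r s - mm n Z Y r s)"
  by (simp add: fun_eq_iff mm_def right_diff_distrib sum_subtractf)

lemma mm_identity_left:
  assumes "\<And>r s. r \<in> {1..n+1} \<Longrightarrow> s \<in> {1..n+1} \<Longrightarrow> I r s = (if r = s then 1 else 0)"
    and "r \<in> {1..n+1}"
  shows "mm n I Z r s = Z r s"
proof -
  have "mm n I Z r s = (\<Sum>t\<in>{1..n+1}. if t = r then Z r s else 0)"
    unfolding mm_def using assms by (intro sum.cong) auto
  then show ?thesis using assms(2) by simp
qed

lemma mat_rep_conj:
  assumes RQ: "\<And>r s. r \<in> {1..n+1} \<Longrightarrow> s \<in> {1..n+1} \<Longrightarrow> mm n R Q r s = (if r = s then 1 else 0)"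
  shows "mat_rep n (\<lambda>g. mm n Q (mm n (gmat g) R))"
proof
  fix a b r s assume ab: "valid_gen n a" "valid_gen n b"
  let ?A = "\<lambda>g. mm n Q (mm n (gmat g) R)"
  \<comment> \<open>\<open>R Q\<close> is the identity only on the index range, which suffices
    because \<open>t\<close> will be a summation index.\<close>
  have cancel: "mm n R (mm n Q Z) t s = Z t s" if "t \<in> {1..n+1}" for Z t s
    unfolding mm_assoc[symmetric] using mm_identity_left[of n "mm n R Q", OF RQ that] .
  have mul: "mm n (?A a) (?A b) = mm n Q (mm n (mm n (gmat a) (gmat b)) R)" for a b
  proof -
    have "mm n (gmat a) (mm n R (mm n Q (mm n (gmat b) R))) = mm n (gmat a) (mm n (gmat b) R)"
      by (intro ext) (simp add: mm_def[of n "gmat a"] cancel)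
    then show ?thesis by (simp only: mm_assoc)
  qed
  have "comm_mat n a b = (\<lambda>r s. mm n (gmat a) (gmat b) r s - mm n (gmat b) (gmat a) r s)"
    by (intro ext) (simp add: comm_mat_def mm_def sum_subtractf)
  then have "mm n Q (mm n (comm_mat n a b) R) r s = mm n (?A a) (?A b) r s - mm n (?A b) (?A a) r s"
    unfolding mul by (simp only: mm_diff_left mm_diff_right)
  moreover have "comm_mat n a b = (\<lambda>r s. \<Sum>g | valid_gen n g. coord (comm_mat n a b) g * gmat g r s)"
    using comm_mat_eq_sum[OF ab] by (intro ext)
  then have "mm n Q (mm n (comm_mat n a b) R) r s
      = mm n Q (mm n (\<lambda>r s. \<Sum>g | valid_gen n g. coord (comm_mat n a b) g * gmat g r s) R) r s"
    by simp
  ultimately show "(\<Sum>t\<in>{1..n+1}. ?A a r t * ?A b t s - ?A b r t * ?A a t s)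
      = (\<Sum>g | valid_gen n g. coord (comm_mat n a b) g * ?A g r s)"
    unfolding mm_sum_left mm_sum_right by (simp add: mm_def[of n "?A a"] mm_def[of n "?A b"] sum_subtractf)
qed

section \<open>Polynomials in one generator\<close>

text \<open>Polynomials are given by their roots. This covers powers of \<open>E i j\<close>, with
  all roots 0, and a polynomial killing \<open>H i\<close>, whose roots are the possible
  eigenvalues.\<close>

fun gpoly :: "gen \<Rightarrow> complex list \<Rightarrow> telt" where
  "gpoly a [] = tone"
| "gpoly a (c # cs) = tmul (\<lambda>w. tgen a w - tconst c w) (gpoly a cs)"

lemma tmul_linear_factor:
  "tmul (\<lambda>w. tgen a w - tconst c w) y w
    = (case w of [] \<Rightarrow> 0 | b # v \<Rightarrow> if b = a then y v else 0) - c * y w"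
proof -
  have "tmul (tgen a) y w = (\<Sum>p | fst p @ snd p = w. if p = ([a], tl w) then y (tl w) else 0)"
    unfolding tmul_eq_sum_splits by (intro sum.cong) (auto simp: tgen_def prod_eq_iff)
  also have "\<dots> = (case w of [] \<Rightarrow> 0 | b # v \<Rightarrow> if b = a then y v else 0)"
    using finite_splits[of w] by (auto split: list.splits)
  moreover have "tmul (tconst c) y w = (\<Sum>p | fst p @ snd p = w. if p = ([], w) then c * y w else 0)"
    unfolding tmul_eq_sum_splits by (intro sum.cong) (auto simp: tconst_def prod_eq_iff)
  then have "tmul (tconst c) y w = c * y w"
    using finite_splits[of w] by simp
  ultimately show ?thesis by (simp add: tmul_diff_left)
qed

lemma gpoly_support: "gpoly a cs w \<noteq> 0 \<Longrightarrow> \<exists>m\<le>length cs. w = replicate m a"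
proof (induction cs arbitrary: w)
  case Nil
  then show ?case by (simp add: tone_eq_tmono tmono_def split: if_splits)
next
  case (Cons c cs)
  then have "(case w of [] \<Rightarrow> 0 | b # v \<Rightarrow> if b = a then gpoly a cs v else 0) \<noteq> 0 \<or> gpoly a cs w \<noteq> 0"
    by (auto simp: tmul_linear_factor)
  then show ?case
  proof
    assume "(case w of [] \<Rightarrow> 0 | b # v \<Rightarrow> if b = a then gpoly a cs v else 0) \<noteq> 0"
    then obtain v where v: "w = a # v" "gpoly a cs v \<noteq> 0" by (auto split: list.splits if_splits)
    then obtain m where "m \<le> length cs" "v = replicate m a" using Cons.IH by blast
    then show ?thesis using v by (intro exI[of _ "Suc m"]) simp
  next
    assume "gpoly a cs w \<noteq> 0"
    then obtain m where "m \<le> length cs" "w = replicate m a" using Cons.IH by blast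
    then show ?thesis by (intro exI[of _ m]) simp
  qed
qed

lemma gpoly_lead: "gpoly a cs (replicate (length cs) a) = 1"
proof (induction cs)
  case (Cons c cs)
  have "gpoly a cs (replicate (length (c # cs)) a) = 0"
  proof (rule ccontr)
    assume "gpoly a cs (replicate (length (c # cs)) a) \<noteq> 0"
    then obtain m where "m \<le> length cs" "replicate (length (c # cs)) a = replicate m a"
      using gpoly_support by blast
    then show False by (metis Suc_n_not_le_n length_Cons length_replicate)
  qed
  then show ?case using Cons by (simp add: tmul_linear_factor)
qed (simp add: tone_eq_tmono tmono_def)

lemma gpoly_in_Talg: "valid_gen n a \<Longrightarrow> gpoly a cs \<in> Talg n"
proof (induction cs)
  case Nil
  then show ?case by (auto simp: tone_eq_tmono intro: tmono_in_Talg)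
next
  case (Cons c cs)
  then show ?case unfolding gpoly.simps tgen_eq_tmono
    by (intro tmul_in_Talg diff_in_Talg tmono_in_Talg tconst_in_Talg) auto
qed

lemma tdeg_gpoly: "valid_gen n a \<Longrightarrow> tdeg (gpoly a cs) = length cs"
proof (rule antisym)
  assume a: "valid_gen n a"
  note fin = Talg_finite[OF gpoly_in_Talg[OF a, of cs]]
  show "length cs \<le> tdeg (gpoly a cs)"
    using length_le_tdeg[OF fin, of "replicate (length cs) a"] gpoly_lead[of a cs] by simp
  have eq: "{length w | w. gpoly a cs w \<noteq> 0} = length ` {w. gpoly a cs w \<noteq> 0}" by auto
  have "length w \<le> length cs" if "gpoly a cs w \<noteq> 0" for w
    using gpoly_support[OF that] by auto
  then show "tdeg (gpoly a cs) \<le> length cs"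
    unfolding tdeg_def eq using fin by (subst Max_le_iff) auto
qed

lemma symbol_eval_gpoly:
  assumes "valid_gen n a"
  shows "symbol_eval (gpoly a cs) \<xi> = \<xi> a ^ length cs"
proof -
  have "{w. gpoly a cs w \<noteq> 0 \<and> length w = length cs} = {replicate (length cs) a}"
    using gpoly_support[of a cs] gpoly_lead[of a cs] by fastforce
  then show ?thesis
    unfolding symbol_eval_def tdeg_gpoly[OF assms] by (simp add: gpoly_lead)
qed

text \<open>The symbol is a power of the linear form \<open>a\<close>, so a representation in which
  \<open>a\<close> has a nonzero off-diagonal entry is enough.\<close>

lemma gpoly_reduced:
  assumes a: "valid_gen n a"
  shows "reduced n (gpoly a cs)"
proof (cases a)
  case (E i j)
  interpret mat_rep n gmat by (rule mat_rep_gmat)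
  show ?thesis
    by (rule reduced_if_symbol_nonzero[of _ i j])
      (use a E in \<open>auto intro: gpoly_in_Talg simp: symbol_eval_gpoly[OF a, unfolded E]\<close>)
next
  case (H i)
  \<comment> \<open>\<open>H i\<close> is diagonal, so the coefficient test only sees it after conjugation by \<open>1 + E\<^sub>i\<^sub>,\<^sub>i\<^sub>+\<^sub>1\<close>.\<close>
  define Q where "Q r s = (if r = s then 1 else if r = i \<and> s = i + 1 then -1 else 0 :: complex)" for r s
  define R where "R r s = (if r = s then 1 else if r = i \<and> s = i + 1 then 1 else 0 :: complex)" for r s
  have i: "1 \<le> i" "i \<le> n" using a H by auto
  have RQ: "mm n R Q r s = (if r = s then 1 else 0)" if "r \<in> {1..n+1}" "s \<in> {1..n+1}" for r s
  proof -
    have "mm n R Q r s = (\<Sum>t\<in>{1..n+1}. (if t = r then Q r s else 0)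
        + (if t = i + 1 then (if r = i then Q (i + 1) s else 0) else 0))"
      unfolding mm_def by (intro sum.cong) (auto simp: R_def)
    also have "\<dots> = Q r s + (if r = i then Q (i + 1) s else 0)"
      using that i by (simp add: sum.distrib)
    also have "\<dots> = (if r = s then 1 else 0)" by (auto simp: Q_def)
    finally show ?thesis .
  qed
  have "mm n (gmat (H i)) R r (i + 1) = of_int (hval i r) * R r (i + 1)" for r
  proof -
    have "mm n (gmat (H i)) R r (i + 1)
       = (\<Sum>t\<in>{1..n+1}. if t = r then of_int (hval i r) * R r (i + 1) else 0)"
      unfolding mm_def gmat_H_eq by (intro sum.cong) auto
    also have "\<dots> = of_int (hval i r) * R r (i + 1)" using i by (auto simp: hval_def)
    finally show ?thesis .
  qed
  then have "mm n Q (mm n (gmat (H i)) R) i (i + 1)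
      = (\<Sum>t\<in>{1..n+1}. Q i t * (of_int (hval i t) * R t (i + 1)))"
    by (simp add: mm_def[of n Q])
  \<comment> \<open>Two products survive: \<open>1 * 1 * 1\<close> at \<open>t = i\<close> and
    \<open>(-1) * (-1) * 1\<close> at \<open>t = i + 1\<close>.\<close>
  also have "\<dots> = (\<Sum>t\<in>{1..n+1}. (if t = i then 1 else 0) + (if t = i + 1 then 1 else 0))"
    by (intro sum.cong) (auto simp: Q_def R_def hval_def)
  also have "\<dots> = 2" using i by (simp add: sum.distrib)
  finally have two: "mm n Q (mm n (gmat a) R) i (i + 1) = 2" by (simp add: H)
  interpret mat_rep n "\<lambda>g. mm n Q (mm n (gmat g) R)" by (rule mat_rep_conj[OF RQ])
  show ?thesis
    by (rule reduced_if_symbol_nonzero[of _ i "i + 1"])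
      (use a i in \<open>auto intro: gpoly_in_Talg simp: symbol_eval_gpoly[OF a] two[simplified]\<close>)
qed

section \<open>Nilpotency and diagonalisability on tensor powers\<close>

lemma act_E:
  assumes "valid_gen n (E i j)"
  shows "act n D (gmat (E i j)) f w = (\<Sum>k\<in>D. if w k = i then f (w(k := j)) else 0)"
proof -
  have "(\<Sum>c\<in>{1..n+1}. gmat (E i j) (w k) c * f (w(k := c))) = (if w k = i then f (w(k := j)) else 0)" for k
  proof -
    have "(\<Sum>c\<in>{1..n+1}. gmat (E i j) (w k) c * f (w(k := c)))
      = (\<Sum>c\<in>{1..n+1}. if c = j then (if w k = i then f (w(k := j)) else 0) else 0)"
      by (intro sum.cong) auto
    then show ?thesis using assms by simp
  qed
  then show ?thesis unfolding act_def by (simp only:)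
qed

lemma act_H:
  assumes "1 \<le> i" "i \<le> n"
  shows "act n D (gmat (H i)) f w = of_int (\<Sum>k\<in>D. hval i (w k)) * f w"
proof -
  have "(\<Sum>c\<in>{1..n+1}. gmat (H i) (w k) c * f (w(k := c))) = of_int (hval i (w k)) * f w" for k
  proof -
    have "(\<Sum>c\<in>{1..n+1}. gmat (H i) (w k) c * f (w(k := c)))
      = (\<Sum>c\<in>{1..n+1}. if c = w k then of_int (hval i (w k)) * f w else 0)"
      unfolding gmat_H_eq by (intro sum.cong) auto
    also have "\<dots> = of_int (hval i (w k)) * f w"
      using assms by (auto simp: hval_def)
    finally show ?thesis .
  qed
  then show ?thesis unfolding act_def by (simp only: sum_distrib_right of_int_sum)
qed

lemma tact_gpoly_Cons:
  assumes "valid_gen n a"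
  shows "tact n D A (gpoly a (c # cs)) f
    = (\<lambda>x. act n D (A a) (tact n D A (gpoly a cs) f) x - c * tact n D A (gpoly a cs) f x)"
proof -
  have "(\<lambda>w. tgen a w - tconst c w) \<in> Talg n" unfolding tgen_eq_tmono
    using assms by (intro diff_in_Talg tmono_in_Talg tconst_in_Talg) auto
  then have "tact n D A (gpoly a (c # cs)) f
     = tact n D A (\<lambda>w. tgen a w - tconst c w) (tact n D A (gpoly a cs) f)"
    unfolding gpoly.simps by (rule tact_tmul) (rule gpoly_in_Talg[OF assms])
  then show ?thesis by (simp add: tact_linear_factor[OF assms])
qed

text \<open>On coordinates each application uses up one letter \<open>i\<close> of \<open>w\<close>,
  so more applications than letters \<open>i\<close> give 0.\<close>

lemma E_power_acts_zero:
  assumes E: "valid_gen n (E i j)" and D: "finite D"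
  shows "card {k\<in>D. w k = i} < m \<Longrightarrow> tact n D gmat (gpoly (E i j) (replicate m 0)) f w = 0"
proof (induction m arbitrary: w)
  case (Suc m)
  let ?g = "tact n D gmat (gpoly (E i j) (replicate m 0)) f"
  have "?g (w(k := j)) = 0" if "k \<in> D" "w k = i" for k
  proof (rule Suc.IH)
    have "{l\<in>D. (w(k := j)) l = i} = {l\<in>D. w l = i} - {k}" using E by auto
    then show "card {l\<in>D. (w(k := j)) l = i} < m" using that D Suc.prems card_Suc_Diff1[of "{l\<in>D. w l = i}" k] by simp
  qed
  then have "act n D (gmat (E i j)) ?g w = 0"
    unfolding act_E[OF E] by (intro sum.neutral) auto
  then show ?case unfolding replicate_Suc tact_gpoly_Cons[OF E] by simp
qed simp

text \<open>\<open>H i\<close> is diagonal on basis words, and each tensor factor contributes -1, 0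
  or 1, so every eigenvalue is one of the listed roots.\<close>

lemma H_poly_acts_zero:
  assumes i: "1 \<le> i" "i \<le> n" and D: "finite D"
  defines "cs \<equiv> map of_int [- int (card D)..int (card D)]"
  shows "tact n D gmat (gpoly (H i) cs) f = (\<lambda>_. 0)"
proof
  fix w
  let ?h = "of_int (\<Sum>k\<in>D. hval i (w k)) :: complex"
  have eval: "tact n D gmat (gpoly (H i) cs) f w = prod_list (map (\<lambda>c. ?h - c) cs) * f w" for cs
  proof (induction cs)
    case Nil
    then show ?case by (simp add: tone_eq_tmono tact_tmono wact_Nil)
  next
    case (Cons c cs)
    have "valid_gen n (H i)" using i by simp
    then show ?case
      unfolding tact_gpoly_Cons[OF \<open>valid_gen n (H i)\<close>] act_H[OF i] Cons by (simp add: algebra_simps)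
  qed
  have "\<bar>\<Sum>k\<in>D. hval i (w k)\<bar> \<le> (\<Sum>k\<in>D. 1)"
    by (rule order_trans[OF sum_abs sum_mono]) (auto simp: hval_def)
  then have "(\<Sum>k\<in>D. hval i (w k)) \<in> {- int (card D)..int (card D)}" by auto
  then have "?h \<in> set cs" unfolding cs_def set_map set_upto by (rule imageI)
  then have "0 \<in> set (map (\<lambda>c. ?h - c) cs)" by force
  then show "tact n D gmat (gpoly (H i) cs) f w = 0"
    unfolding eval prod_list_zero_iff[symmetric] by simp
qed

section \<open>Highest weight vectors of dominant weight\<close>

text \<open>The Levi-Civita symbol, that is, the coordinates of e1 \<and> ... \<and> em. Positions
  start at 0 and letters at 1, hence the shift that turns \<open>u\<close> into a permutation of
  \<open>{..<m}\<close>.\<close>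

definition eps :: "nat \<Rightarrow> (nat \<Rightarrow> nat) \<Rightarrow> complex" where
  "eps m u = (if bij_betw u {..<m} {1..m} then of_int (sign (\<lambda>k. if k < m then u k - 1 else k)) else 0)"

lemma permutes_of_bij_betw:
  fixes m :: nat
  assumes "bij_betw u {..<m} {1..m}"
  shows "(\<lambda>k. if k < m then u k - 1 else k) permutes {..<m}"
proof (rule bij_imp_permutes)
  have "bij_betw (\<lambda>k. k - 1) {1..m} {..<m}"
    by (rule bij_betw_byWitness[where f' = Suc]) auto
  then have "bij_betw ((\<lambda>k. k - 1) \<circ> u) {..<m} {..<m}"
    using assms by (rule bij_betw_trans[rotated])
  then show "bij_betw (\<lambda>k. if k < m then u k - 1 else k) {..<m} {..<m}"
    by (rule iffD1[OF bij_betw_cong, rotated]) simp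
qed simp

lemma eps_swap:
  assumes "k < m" "l < m" "k \<noteq> l"
  shows "eps m (u \<circ> transpose k l) = - eps m u"
proof (cases "bij_betw u {..<m} {1..m}")
  case True
  let ?\<pi> = "\<lambda>k. if k < m then u k - 1 else k"
  have t: "transpose k l permutes {..<m}" using assms by (intro permutes_swap_id) auto
  have "bij_betw (u \<circ> transpose k l) {..<m} {1..m}"
    using permutes_imp_bij[OF t] True by (rule bij_betw_trans)
  moreover have "(\<lambda>j. if j < m then (u \<circ> transpose k l) j - 1 else j) = ?\<pi> \<circ> transpose k l"
    using assms by (auto simp: fun_eq_iff transpose_def)
  moreover have "sign (?\<pi> \<circ> transpose k l) = - sign ?\<pi>"
    using permutes_of_bij_betw[OF True] assms
    by (subst sign_compose)
      (auto simp: sign_swap_id permutation_swap_id intro: permutes_imp_permutation[of "{..<m}"])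
  ultimately show ?thesis using True by (simp add: eps_def)
next
  case False
  have t: "transpose k l permutes {..<m}" using assms by (intro permutes_swap_id) auto
  have "\<not> bij_betw (u \<circ> transpose k l) {..<m} {1..m}"
  proof
    assume "bij_betw (u \<circ> transpose k l) {..<m} {1..m}"
    then have "bij_betw ((u \<circ> transpose k l) \<circ> transpose k l) {..<m} {1..m}"
      using permutes_imp_bij[OF t] by (rule bij_betw_trans[rotated])
    with False show False by (simp add: comp_assoc)
  qed
  with False show ?thesis by (simp add: eps_def)
qed

text \<open>A raising operator kills e1 \<and> ... \<and> em: if some term is nonzero, exactly two
  positions carry \<open>i\<close>, and their terms differ by a transposition and cancel.\<close>

lemma eps_raise:
  assumes "1 \<le> i" "i < j"
  shows "(\<Sum>k<m. if u k = i then eps m (u(k := j)) else 0) = 0"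
proof (cases "\<exists>k<m. u k = i \<and> eps m (u(k := j)) \<noteq> 0")
  case True
  then obtain k where k: "k < m" "u k = i" "eps m (u(k := j)) \<noteq> 0" by blast
  then have bij: "bij_betw (u(k := j)) {..<m} {1..m}" by (auto simp: eps_def split: if_splits)
  have "j \<in> {1..m}" using bij_betwE[OF bij] k(1) by force
  \<comment> \<open>Here \<open>i < j\<close> matters: \<open>j\<close> is at most \<open>m\<close>,
    hence so is \<open>i\<close>, and the bijection must take the value \<open>i\<close> at a second
    position.\<close>
  then have "i \<in> (u(k := j)) ` {..<m}" using assms bij_betw_imp_surj_on[OF bij] by auto
  then obtain l where l: "l < m" "(u(k := j)) l = i" by auto
  with assms have lk: "l \<noteq> k" "u l = i" by (auto split: if_splits)
  have uniq: "x = l" if "x < m" "x \<noteq> k" "u x = i" for x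
    using inj_onD[OF bij_betw_imp_inj_on[OF bij], of x l] that l lk by simp
  have "(\<Sum>x<m. if u x = i then eps m (u(x := j)) else 0)
      = (\<Sum>x\<in>{k, l}. if u x = i then eps m (u(x := j)) else 0)"
    by (rule sum.mono_neutral_right) (use k l uniq in auto)
  also have "\<dots> = eps m (u(k := j)) + eps m (u(l := j))" using k lk by simp
  also have "u(l := j) = u(k := j) \<circ> transpose k l"
    using k lk by (auto simp: fun_eq_iff transpose_def)
  finally show ?thesis unfolding eps_swap[OF k(1) l(1) lk(1)[symmetric]] right_minus .
qed (auto intro: sum.neutral)

lemma eps_weight:
  assumes "eps m u \<noteq> 0" "1 \<le> i"
  shows "(\<Sum>k<m. hval i (u k)) = (if m = i then 1 else 0)"
proof -
  have "bij_betw u {..<m} {1..m}" using assms(1) by (auto simp: eps_def split: if_splits)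
  then have "(\<Sum>k<m. hval i (u k)) = (\<Sum>r\<in>{1..m}. hval i r)" by (rule sum.reindex_bij_betw)
  then show ?thesis using sum_hval[OF assms(2)] by simp
qed

lemma eps_Suc: "eps m Suc = 1"
proof -
  have "bij_betw Suc {..<m} {1..m}" by (rule bij_betw_byWitness[where f' = "\<lambda>k. k - 1"]) auto
  moreover have "(\<lambda>k. if k < m then Suc k - 1 else k) = id" by auto
  ultimately show ?thesis by (simp add: eps_def sign_id del: One_nat_def)
qed

text \<open>
  The vector of weight \<open>\<Sum>\<^sub>m a\<^sub>m \<omega>\<^sub>m\<close> is the product of \<open>a\<^sub>m\<close> copies of \<open>e\<^sub>1 \<and> \<dots> \<and> e\<^sub>m\<close> for each \<open>m\<close>; a block is
  a pair of \<open>m\<close> and the number of the copy.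
\<close>
definition blocks :: "nat \<Rightarrow> (nat \<Rightarrow> nat) \<Rightarrow> (nat \<times> nat) set" where
  "blocks n a = Sigma {1..n} (\<lambda>m. {..<a m})"

definition positions :: "nat \<Rightarrow> (nat \<Rightarrow> nat) \<Rightarrow> ((nat \<times> nat) \<times> nat) set" where
  "positions n a = Sigma (blocks n a) (\<lambda>b. {..<fst b})"

definition hwvec :: "nat \<Rightarrow> (nat \<Rightarrow> nat) \<Rightarrow> ((nat \<times> nat) \<times> nat \<Rightarrow> nat) \<Rightarrow> complex" where
  "hwvec n a w = (\<Prod>b\<in>blocks n a. eps (fst b) (\<lambda>k. w (b, k)))"

lemma finite_blocks: "finite (blocks n a)"
  by (simp add: blocks_def)

lemma finite_positions: "finite (positions n a)"
  by (simp add: positions_def finite_blocks)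

lemma sum_positions: "(\<Sum>p\<in>positions n a. g p) = (\<Sum>b\<in>blocks n a. \<Sum>k<fst b. g (b, k))"
  unfolding positions_def by (subst sum.Sigma) (auto simp: finite_blocks split_def)

text \<open>Changing a letter in one block leaves the factors of the other blocks alone, so the sum
  vanishes block by block.\<close>

lemma hwvec_E:
  assumes "valid_gen n (E i j)" "i < j"
  shows "act n (positions n a) (gmat (E i j)) (hwvec n a) = (\<lambda>_. 0)"
proof
  fix w
  have "(\<Sum>k<fst b. if w (b, k) = i then hwvec n a (w((b, k) := j)) else 0) = 0"
    if b: "b \<in> blocks n a" for b
  proof -
    let ?r = "\<Prod>b'\<in>blocks n a - {b}. eps (fst b') (\<lambda>k. w (b', k))" and ?u = "\<lambda>k. w (b, k)"
    have "hwvec n a (w((b, k) := j)) = eps (fst b) (?u(k := j)) * ?r" for k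
    proof -
      have "hwvec n a (w((b, k) := j)) = eps (fst b) (\<lambda>l. (w((b, k) := j)) (b, l))
        * (\<Prod>b'\<in>blocks n a - {b}. eps (fst b') (\<lambda>l. (w((b, k) := j)) (b', l)))"
        unfolding hwvec_def using b finite_blocks by (rule prod.remove[rotated])
      also have "(\<lambda>l. (w((b, k) := j)) (b, l)) = ?u(k := j)" by auto
      also have "(\<Prod>b'\<in>blocks n a - {b}. eps (fst b') (\<lambda>l. (w((b, k) := j)) (b', l))) = ?r"
        by (intro prod.cong refl arg_cong[where f = "eps _"]) auto
      finally show ?thesis .
    qed
    then have "(\<Sum>k<fst b. if w (b, k) = i then hwvec n a (w((b, k) := j)) else 0)
      = (\<Sum>k<fst b. (if ?u k = i then eps (fst b) (?u(k := j)) else 0) * ?r)"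
      by (intro sum.cong) auto
    also have "\<dots> = 0"
      using eps_raise[of i j ?u "fst b"] assms unfolding sum_distrib_right[symmetric] by simp
    finally show ?thesis .
  qed
  then show "act n (positions n a) (gmat (E i j)) (hwvec n a) w = 0"
    unfolding act_E[OF assms(1)] sum_positions by (rule sum.neutral[OF ballI])
qed

lemma hwvec_H:
  assumes "1 \<le> i" "i \<le> n"
  shows "act n (positions n a) (gmat (H i)) (hwvec n a) = (\<lambda>w. of_nat (a i) * hwvec n a w)"
proof
  fix w
  show "act n (positions n a) (gmat (H i)) (hwvec n a) w = of_nat (a i) * hwvec n a w"
  proof (cases "hwvec n a w = 0")
    case True
    then show ?thesis by (simp add: act_H[OF assms])
  next
    case False
    then have "eps (fst b) (\<lambda>k. w (b, k)) \<noteq> 0" if "b \<in> blocks n a" for b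
      using that finite_blocks by (auto simp: hwvec_def)
    then have "(\<Sum>p\<in>positions n a. hval i (w p)) = (\<Sum>b\<in>blocks n a. if fst b = i then 1 else 0)"
      unfolding sum_positions using eps_weight assms(1) by (intro sum.cong refl) simp
    also have "\<dots> = (\<Sum>m\<in>{1..n}. \<Sum>c<a m. if m = i then 1 else 0)"
      unfolding blocks_def by (subst sum.Sigma) (auto simp: split_def)
    also have "\<dots> = (\<Sum>m\<in>{1..n}. if m = i then int (a i) else 0)"
      by (intro sum.cong) auto
    also have "\<dots> = int (a i)" using assms by simp
    finally show ?thesis by (simp add: act_H[OF assms] del: of_int_sum)
  qed
qed

lemma hwvec_nonzero: "hwvec n a \<noteq> (\<lambda>_. 0)"
proof -
  \<comment> \<open>In this word every block reads 1, 2, ..., m, the identity permutation.\<close>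
  have "hwvec n a (\<lambda>p. Suc (snd p)) = 1" by (simp add: hwvec_def eps_Suc)
  then show ?thesis by force
qed

section \<open>Associated varieties\<close>

text \<open>Symbols of positive degree vanish at 0. In degree 0 a nonzero constant would put
  \<open>tone\<close> into a proper left ideal.\<close>

lemma zero_in_assoc_variety: "(\<lambda>_. 0) \<in> assoc_variety n \<mu>"
proof -
  have "symbol_eval t (\<lambda>_. 0) = 0" if t: "t \<in> annihilator n \<mu>" for t
  proof (cases "tdeg t = 0")
    case False
    show ?thesis unfolding symbol_eval_def
    proof (rule sum.neutral, rule ballI)
      fix w assume "w \<in> {w. t w \<noteq> 0 \<and> length w = tdeg t}"
      then have "w \<noteq> []" using False by auto
      then show "t w * prod_list (map (\<lambda>_. 0) w) = 0" by (cases w) auto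
    qed
  next
    case True
    have T: "t \<in> Talg n" using t by (simp add: annihilator_def)
    have supp: "w = []" if "t w \<noteq> 0" for w
      using length_le_tdeg[OF Talg_finite[OF T] that] True by simp
    have "tmul t tone \<in> simple_left_ideal n \<mu>"
      using t unfolding annihilator_def tone_eq_tmono by (auto simp: tmono_in_Talg)
    then obtain K where K: "is_left_ideal n K" "tone \<notin> K" "t \<in> K"
      by (auto simp: simple_left_ideal_def tmul_tone_right)
    have "t [] = 0"
    proof (rule ccontr)
      assume nz: "t [] \<noteq> 0"
      have "(\<lambda>w. inverse (t []) * t w) \<in> K" using K unfolding is_left_ideal_def by blast
      moreover have "inverse (t []) * t w = tone w" for w
        using nz supp[of w] by (auto simp: tone_def tconst_def)
      ultimately show False using K(2) by simp
    qed
    then show ?thesis using supp unfolding symbol_eval_def by (intro sum.neutral) auto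
  qed
  then show ?thesis by (simp add: assoc_variety_def)
qed

lemma assoc_variety_dominant:
  assumes \<mu>: "\<And>i. 1 \<le> i \<Longrightarrow> i \<le> n \<Longrightarrow> \<mu> i \<in> \<nat>"
  shows "assoc_variety n \<mu> = {\<lambda>_. 0}"
proof -
  have "\<forall>i. \<exists>m. 1 \<le> i \<longrightarrow> i \<le> n \<longrightarrow> \<mu> i = of_nat m" using \<mu> by (auto simp: Nats_def)
  then obtain a where a: "\<And>i. 1 \<le> i \<Longrightarrow> i \<le> n \<Longrightarrow> \<mu> i = of_nat (a i)" by metis
  let ?D = "positions n a"
  interpret mat_rep n gmat by (rule mat_rep_gmat)
  have ann: "u \<in> annihilator n \<mu>" if "u \<in> Talg n" "\<And>f. tact n ?D gmat u f = (\<lambda>_. 0)" for u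
    using that hwvec_E hwvec_H hwvec_nonzero a
    by (intro annihilator_highest_weight[OF finite_positions[of n a], where v = "hwvec n a"]) auto
  have zero: "\<xi> g = 0" if \<xi>: "\<xi> \<in> assoc_variety n \<mu>" and g: "valid_gen n g" for \<xi> g
  proof -
    \<comment> \<open>The list must be nonempty so that \<open>\<xi> g ^ length cs = 0\<close>
      yields \<open>\<xi> g = 0\<close>.\<close>
    have "\<exists>cs. cs \<noteq> [] \<and> (\<forall>f. tact n ?D gmat (gpoly g cs) f = (\<lambda>_. 0))"
    proof (cases g)
      case (E i j)
      \<comment> \<open>One more than the number of tensor factors bounds the letters
        \<open>i\<close> in every word, so a single power works uniformly.\<close>
      have "card {k \<in> ?D. w k = i} < Suc (card ?D)" for w
        using card_mono[OF finite_positions, of "{k \<in> ?D. w k = i}" n a] by auto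
      then have "tact n ?D gmat (gpoly g (replicate (Suc (card ?D)) 0)) f = (\<lambda>_. 0)" for f
        using E_power_acts_zero[OF g[unfolded E] finite_positions] unfolding E by blast
      then show ?thesis by (intro exI[of _ "replicate (Suc (card ?D)) 0"]) auto
    next
      case (H i)
      have "tact n ?D gmat (gpoly g (map of_int [- int (card ?D)..int (card ?D)])) f = (\<lambda>_. 0)" for f
        using H_poly_acts_zero[of i n ?D f] g finite_positions unfolding H by simp
      then show ?thesis by (intro exI[of _ "map of_int [- int (card ?D)..int (card ?D)]"]) auto
    qed
    then obtain cs where cs: "cs \<noteq> []" "\<And>f. tact n ?D gmat (gpoly g cs) f = (\<lambda>_. 0)" by blast
    have "gpoly g cs \<in> annihilator n \<mu>" by (rule ann[OF gpoly_in_Talg[OF g] cs(2)])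
    then have "symbol_eval (gpoly g cs) \<xi> = 0"
      using \<xi> gpoly_reduced[OF g] by (simp add: assoc_variety_def)
    then show ?thesis by (simp add: symbol_eval_gpoly[OF g])
  qed
  have "\<xi> = (\<lambda>_. 0)" if "\<xi> \<in> assoc_variety n \<mu>" for \<xi>
  proof
    fix g
    show "\<xi> g = 0" using zero[OF that, of g] that by (cases "valid_gen n g") (auto simp: assoc_variety_def)
  qed
  then show ?thesis using zero_in_assoc_variety by blast
qed

lemma assoc_variety_eq_zero_iff:
  "assoc_variety n \<mu> = {\<lambda>_. 0} \<longleftrightarrow> (\<forall>i\<in>{1..n}. \<mu> i \<in> \<nat>)"
proof
  assume v: "assoc_variety n \<mu> = {\<lambda>_. 0}"
  show "\<forall>i\<in>{1..n}. \<mu> i \<in> \<nat>"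
  proof (rule ccontr)
    assume "\<not> ?thesis"
    then obtain i where "1 \<le> i" "i \<le> n" "\<mu> i \<notin> \<nat>" by auto
    then have "dual_F i \<in> assoc_variety n \<mu>" by (rule dual_F_in_assoc_variety)
    then have "dual_F i (E (i+1) i) = 0" unfolding v by simp
    then show False by (simp add: dual_F_def)
  qed
qed (rule assoc_variety_dominant, simp)

section \<open>Admissible weights\<close>

lemma root_pair_ecoord:
  assumes "a \<le> b" "b \<le> n + 1"
  shows "root_pair \<mu> (a, b) = ecoord n \<mu> a - ecoord n \<mu> b"
proof -
  have "{a..n} = {a..<b} \<union> {b..n}" using assms by auto
  moreover have "sum \<mu> ({a..<b} \<union> {b..n}) = sum \<mu> {a..<b} + sum \<mu> {b..n}"
    by (rule sum.union_disjoint) auto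
  ultimately show ?thesis by (simp add: root_pair_def ecoord_def)
qed

text \<open>The left side is the pairing with \<theta>. Telescoping moves the Weyl group element
  onto the root, and \<open>of_nat n\<close> is the pairing of \<rho> with \<theta>.\<close>

lemma sum_dot_act:
  "(\<Sum>l\<in>{1..n}. dot_act n \<sigma> \<mu> l) =
    ecoord n (\<lambda>i. \<mu> i + rho n i) (inv \<sigma> 1) - ecoord n (\<lambda>i. \<mu> i + rho n i) (inv \<sigma> (n + 1)) - of_nat n"
proof -
  have telescope: "(\<Sum>l\<in>{1..m}. e l - e (Suc l)) = e 1 - e (m + 1)" for e :: "nat \<Rightarrow> rat" and m
    by (induction m) (auto simp: sum.cl_ivl_Suc)
  let ?e = "\<lambda>l. ecoord n (\<lambda>i. \<mu> i + rho n i) (inv \<sigma> l)"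
  have "(\<Sum>l\<in>{1..n}. dot_act n \<sigma> \<mu> l) = (\<Sum>l\<in>{1..n}. ?e l - ?e (Suc l)) - (\<Sum>l\<in>{1..n}. 1)"
    unfolding sum_subtractf[symmetric] by (intro sum.cong) (auto simp: dot_act_def weyl_act_def rho_def)
  also have "(\<Sum>l\<in>{1..n}. ?e l - ?e (Suc l)) = ?e 1 - ?e (n + 1)"
    using telescope[of ?e n] .
  finally show ?thesis by simp
qed

text \<open>All coordinates are nonnegative and \<rho> contributes at least 1; the sum over all
  simple roots is at most \<open>(p - n - 1) + n\<close>.\<close>

lemma root_pair_le:
  assumes \<mu>: "\<mu> \<in> PrZ n p" and ab: "1 \<le> a" "a < b" "b \<le> n + 1"
  shows "1 \<le> root_pair (\<lambda>i. \<mu> i + rho n i) (a, b)"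
    and "root_pair (\<lambda>i. \<mu> i + rho n i) (a, b) \<le> of_nat p - 1"
proof -
  let ?f = "\<lambda>i. \<mu> i + rho n i"
  have nonneg: "0 \<le> \<mu> i" for i using \<mu> by (auto simp: PrZ_def Nats_def dest: spec[of _ i])
  then have pos: "0 \<le> ?f i" for i by (simp add: rho_def)
  have one: "1 \<le> ?f a" using nonneg[of a] ab by (simp add: rho_def)
  have "?f a \<le> (\<Sum>l\<in>{a..<b}. ?f l)" using ab pos by (intro member_le_sum) auto
  with one show "1 \<le> root_pair ?f (a, b)" by (simp add: root_pair_def)
  have "(\<Sum>l\<in>{a..<b}. ?f l) \<le> (\<Sum>l\<in>{1..n}. ?f l)" using ab pos by (intro sum_mono2) auto
  also have "\<dots> = (\<Sum>l\<in>{1..n}. \<mu> l) + (\<Sum>l\<in>{1..n}. 1)"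
    unfolding sum.distrib[symmetric] by (intro sum.cong) (auto simp: rho_def)
  also have "\<dots> \<le> of_nat p - 1" using \<mu> by (simp add: PrZ_def)
  finally show "root_pair ?f (a, b) \<le> of_nat p - 1" by (simp add: root_pair_def)
qed

lemma root_pair_shift:
  "root_pair (\<lambda>i. shift p q \<mu> \<eta> i + rho n i) r
    = root_pair (\<lambda>i. \<mu> i + rho n i) r - of_nat p / of_nat q * of_int (root_pair \<eta> r)"
  unfolding root_pair_def shift_def of_int_sum sum_distrib_left sum_subtractf[symmetric]
  by (intro sum.cong) auto

lemma sum_Pr_adm_le:
  assumes \<mu>: "\<mu> \<in> Pr_adm n p q" and n: "n \<ge> 1" and q: "q > 0"
  shows "(\<Sum>l\<in>{1..n}. \<mu> l) \<le> of_nat p - of_nat n - 1"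
proof -
  obtain \<nu> \<sigma> \<eta> where \<mu>_eq: "\<mu> = dot_act n \<sigma> (shift p q \<nu> \<eta>)" and \<nu>: "\<nu> \<in> PrZ n p"
    and \<sigma>: "\<sigma> permutes {1..n+1}" and C: "cond_C n q \<sigma> \<eta>"
    using \<mu> unfolding Pr_adm_def by blast
  \<comment> \<open>The root \<theta> is the image under \<open>\<sigma>\<close> of the root with
    indices \<open>a\<close> and \<open>b\<close>, which may be positive or negative.\<close>
  define a b where "a = inv \<sigma> 1" and "b = inv \<sigma> (n + 1)"
  have ab: "a \<in> {1..n+1}" "b \<in> {1..n+1}"
    using permutes_in_image[OF permutes_inv[OF \<sigma>]] by (auto simp: a_def b_def simp del: One_nat_def)
  have \<sigma>ab: "\<sigma> a = 1" "\<sigma> b = n + 1"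
    using permutes_inverses(1)[OF \<sigma>] by (simp_all add: a_def b_def)
  then have "a \<noteq> b" using n by auto
  let ?f = "\<lambda>i. shift p q \<nu> \<eta> i + rho n i"
  have "ecoord n ?f a - ecoord n ?f b \<le> of_nat p - 1"
  proof (cases "a < b")
    case True
    then have r: "(a, b) \<in> pos_roots n" using ab by (auto simp: pos_roots_def)
    \<comment> \<open>For a positive root the shift by \<open>\<eta>\<close> can only lower the
      pairing.\<close>
    have "0 \<le> root_pair \<eta> (a, b)" using bspec[OF C[unfolded cond_C_def] r] \<sigma>ab n by simp
    then have "0 \<le> of_nat p / of_nat q * (of_int (root_pair \<eta> (a, b)) :: rat)" by simp
    moreover have "ecoord n ?f a - ecoord n ?f b = root_pair ?f (a, b)"
      using True ab by (intro root_pair_ecoord[symmetric]) auto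
    moreover have "root_pair (\<lambda>i. \<nu> i + rho n i) (a, b) \<le> of_nat p - 1"
      using True ab by (intro root_pair_le(2)[OF \<nu>]) auto
    ultimately show ?thesis unfolding root_pair_shift by linarith
  next
    case False
    then have "b < a" using \<open>a \<noteq> b\<close> by simp
    then have r: "(b, a) \<in> pos_roots n" using ab by (auto simp: pos_roots_def)
    \<comment> \<open>Now \<open>\<sigma>\<close> sends the positive root \<open>(b, a)\<close> to a
      negative one, so \<open>C\<close> allows at most \<open>q\<close>. After the sign change the
      shift adds at most \<open>p\<close>, while the pairing with the dominant part takes away at
      least 1.\<close>
    have "root_pair \<eta> (b, a) \<le> int q" using bspec[OF C[unfolded cond_C_def] r] \<sigma>ab n by simp
    then have "of_nat p / of_nat q * (of_int (root_pair \<eta> (b, a)) :: rat)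
        \<le> of_nat p / of_nat q * of_int (int q)"
      by (intro mult_left_mono) (simp_all only: of_int_le_iff, simp)
    also have "\<dots> = of_nat p" using q by simp
    finally have "of_nat p / of_nat q * (of_int (root_pair \<eta> (b, a)) :: rat) \<le> of_nat p" .
    moreover have "ecoord n ?f b - ecoord n ?f a = root_pair ?f (b, a)"
      using \<open>b < a\<close> ab by (intro root_pair_ecoord[symmetric]) auto
    moreover have "1 \<le> root_pair (\<lambda>i. \<nu> i + rho n i) (b, a)"
      using \<open>b < a\<close> ab by (intro root_pair_le(1)[OF \<nu>]) auto
    ultimately show ?thesis unfolding root_pair_shift by linarith
  qed
  then show ?thesis unfolding \<mu>_eq sum_dot_act a_def b_def by simp
qed

lemma supported_Pr_adm: "\<mu> \<in> Pr_adm n p q \<Longrightarrow> supported n \<mu>"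
  by (auto simp: Pr_adm_def supported_def dot_act_def weyl_act_def rho_def)

lemma PrZ_subset_Pr_adm:
  assumes "q > 0"
  shows "PrZ n p \<subseteq> Pr_adm n p q"
proof
  fix \<mu> assume \<mu>: "\<mu> \<in> PrZ n p"
  \<comment> \<open>The witnesses are the trivial Weyl group element and
    \<open>\<eta> = 0\<close>.\<close>
  have "dot_act n id (shift p q \<mu> (\<lambda>_. 0)) = \<mu>"
  proof
    fix l
    have "ecoord n f l - ecoord n f (Suc l) = f l" if "l \<le> n" for f
    proof -
      have "{l..n} = insert l {Suc l..n}" using that by auto
      then show ?thesis by (simp add: ecoord_def)
    qed
    then show "dot_act n id (shift p q \<mu> (\<lambda>_. 0)) l = \<mu> l"
      using \<mu> by (auto simp: dot_act_def weyl_act_def shift_def PrZ_def supported_def rho_def)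
  qed
  moreover have "cond_C n q id (\<lambda>_. 0)"
    using assms by (auto simp: cond_C_def root_pair_def pos_roots_def)
  moreover have "supported n (\<lambda>_. 0 :: int)" by (simp add: supported_def)
  ultimately show "\<mu> \<in> Pr_adm n p q"
    unfolding Pr_adm_def using \<mu> permutes_id[of "{1..n+1}"] by (metis (mono_tags, lifting) mem_Collect_eq)
qed

lemma Lambda_k_eq_PrZ:
  assumes "q > 0"
  shows "Lambda_k n p q = PrZ n p"
proof
  show "Lambda_k n p q \<subseteq> PrZ n p"
  proof
    fix \<mu> assume "\<mu> \<in> Lambda_k n p q"
    then obtain \<nu> \<eta> where *: "\<mu> = shift p q \<nu> \<eta>" "\<nu> \<in> PrZ n p" "supported n \<eta>" "\<forall>i\<in>{1..n}. \<eta> i = 0"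
      unfolding Lambda_k_def by blast
    then have "\<eta> = (\<lambda>_. 0)" by (auto simp: supported_def fun_eq_iff)
    with * show "\<mu> \<in> PrZ n p" by (simp add: shift_def)
  qed
  show "PrZ n p \<subseteq> Lambda_k n p q"
  proof
    fix \<mu> assume "\<mu> \<in> PrZ n p"
    moreover have "\<mu> = shift p q \<mu> (\<lambda>_. 0)" by (simp add: shift_def)
    moreover have "supported n (\<lambda>_. 0 :: int)" by (simp add: supported_def)
    ultimately show "\<mu> \<in> Lambda_k n p q" unfolding Lambda_k_def using assms by fastforce
  qed
qed

theorem mainTheorem4:
  fixes n p q :: nat and k :: rat
  assumes "n \<ge> 1" and "p > 0" and "q > 0" and "coprime p q" and "p \<ge> n + 1"
    and "k + of_nat n + 1 = of_nat p / of_nat q"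
  shows "Pr_zero n p q = Lambda_k n p q \<and> Lambda_k n p q = PrZ n p \<and> PrZ n p \<noteq> {}"
proof (intro conjI)
  show eq: "Lambda_k n p q = PrZ n p" using assms(3) by (rule Lambda_k_eq_PrZ)
  \<comment> \<open>Integrality comes from the associated variety, the bound on the pairing with
    \<theta> from admissibility.\<close>
  have "\<mu> \<in> PrZ n p" if "\<mu> \<in> Pr_adm n p q" "\<forall>i\<in>{1..n}. \<mu> i \<in> \<nat>" for \<mu>
  proof -
    have supp: "supported n \<mu>" by (rule supported_Pr_adm[OF that(1)])
    have "\<mu> i \<in> \<nat>" for i
      using that(2) supp by (cases "i \<in> {1..n}") (auto simp: supported_def)
    then show ?thesis using supp sum_Pr_adm_le[OF that(1) assms(1,3)] by (simp add: PrZ_def)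
  qed
  moreover have "\<forall>i\<in>{1..n}. \<mu> i \<in> \<nat>" if "\<mu> \<in> PrZ n p" for \<mu> using that by (simp add: PrZ_def)
  ultimately show "Pr_zero n p q = Lambda_k n p q"
    unfolding eq Pr_zero_def assoc_variety_eq_zero_iff using PrZ_subset_Pr_adm[OF assms(3)] by blast
  \<comment> \<open>This makes the bound \<open>p - n - 1\<close> nonnegative, so the zero weight
    qualifies.\<close>
  have "of_nat (n + 1) \<le> (of_nat p :: rat)" using assms(5) by (simp only: of_nat_le_iff)
  then have "(\<lambda>_. 0) \<in> PrZ n p" by (simp add: PrZ_def supported_def)
  then show "PrZ n p \<noteq> {}" by blast
qed

end
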